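(* Let $P,Q\subset\mathbb{R}^d$ be two convex polyhedra equipped with piecewise constant volume forms $\omega_1$ and $\omega_2$ respectively, such that $\int_P\omega_1=\int_Q\omega_2$. Then there exists a volume-preserving PL-homeomorphism $f:P\to Q$; in particular $f^*(\omega_2)=\omega_1$.
   Context: A PL-homeomorphism is a homeomorphism that is piecewise linear (linear on each simplex of some finite triangulation). A piecewise constant volume form on a polyhedron is a $d$-form $c\,\mathrm{d}x_1\wedge\cdots\wedge\mathrm{d}x_d$ with $c$ a positive function that is constant on each piece of a finite polyhedral decomposition. Volume-preserving means $f^*(\omega_2)=\omega_1$. *)

theory Defs
  imports "HOL-Analysis.Analysis"
begin

text \<open>The simplices of a triangulation are closed and meet in common faces.  Only the values of
  \<open>f\<close> on \<open>P\<close> matter.\<close>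

definition piecewise_linear_on :: "(real ^ 'n) set \<Rightarrow> (real ^ 'n \<Rightarrow> real ^ 'n) \<Rightarrow> bool" where
  "piecewise_linear_on P f \<longleftrightarrow>
     (\<exists>T. triangulation T \<and> \<Union>T = P \<and>
        (\<forall>t\<in>T. \<exists>L b. linear L \<and> (\<forall>x\<in>t. f x = L x + b)))"

definition PL_homeomorphism ::
    "(real ^ 'n) set \<Rightarrow> (real ^ 'n) set \<Rightarrow> (real ^ 'n \<Rightarrow> real ^ 'n) \<Rightarrow> bool" where
  "PL_homeomorphism P Q f \<longleftrightarrow> (\<exists>g. homeomorphism P Q f g) \<and> piecewise_linear_on P f"

text \<open>The cells are not required to meet in common faces.\<close>

definition polyhedral_decomposition :: "(real ^ 'n) set set \<Rightarrow> (real ^ 'n) set \<Rightarrow> bool" where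
  "polyhedral_decomposition D P \<longleftrightarrow>
     finite D \<and> (\<forall>X\<in>D. polytope X) \<and> \<Union>D = P \<and>
     (\<forall>X\<in>D. \<forall>Y\<in>D. X \<noteq> Y \<longrightarrow> interior X \<inter> interior Y = {})"

text \<open>A differential form of top degree assigns to a point a function of a family of \<open>d\<close> tangent
  vectors, \<open>d\<close> being the cardinality of the index type.\<close>

type_synonym 'n form = "real ^ 'n \<Rightarrow> ('n \<Rightarrow> real ^ 'n) \<Rightarrow> real"

text \<open>This is \<open>dx\<^sub>1 \<and> \<dots> \<and> dx\<^sub>d\<close>.\<close>

definition std_volume_form :: "('n \<Rightarrow> real ^ 'n) \<Rightarrow> real" where
  "std_volume_form v = det (\<chi> i j. v i $ j)"

text \<open>The closed cells overlap along their boundaries, so constancy can only be asked for on their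
  interiors; on the remaining null set the density is merely positive.\<close>

definition piecewise_constant_volume_form :: "(real ^ 'n) set \<Rightarrow> 'n form \<Rightarrow> bool" where
  "piecewise_constant_volume_form P \<omega> \<longleftrightarrow>
     (\<exists>c D. polyhedral_decomposition D P \<and> (\<forall>x\<in>P. c x > 0) \<and>
        (\<forall>X\<in>D. c constant_on interior X) \<and>
        (\<forall>x\<in>P. \<forall>v. \<omega> x v = c x * std_volume_form v))"

text \<open>The coefficient of \<open>dx\<^sub>1 \<and> \<dots> \<and> dx\<^sub>d\<close> is the value of the form on the standard basis.\<close>

definition form_integral :: "(real ^ 'n) set \<Rightarrow> 'n form \<Rightarrow> real" where
  "form_integral P \<omega> = integral P (\<lambda>x. \<omega> x (\<lambda>i. axis i 1))"

definition pullback :: "(real ^ 'n \<Rightarrow> real ^ 'n) \<Rightarrow> 'n form \<Rightarrow> 'n form" where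
  "pullback f \<omega> = (\<lambda>x v. \<omega> (f x) (\<lambda>i. frechet_derivative f (at x) (v i)))"

text \<open>Piecewise constant forms have no meaningful values on the boundaries of the pieces, and a
  PL map need not be differentiable there.  Hence \<open>f\<^sup>*\<omega>\<^sub>2 = \<omega>\<^sub>1\<close> is an identity on the interiors of
  all cells of some finite polyhedral decomposition.  It is an identity of forms, so it also fixes
  the orientation.\<close>

definition volume_preserving ::
    "(real ^ 'n) set \<Rightarrow> 'n form \<Rightarrow> 'n form \<Rightarrow> (real ^ 'n \<Rightarrow> real ^ 'n) \<Rightarrow> bool" where
  "volume_preserving P \<omega>1 \<omega>2 f \<longleftrightarrow>
     (\<exists>D. polyhedral_decomposition D P \<and>
        (\<forall>X\<in>D. \<forall>x\<in>interior X. f differentiable (at x) \<and> pullback f \<omega>2 x = \<omega>1 x))"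

end

theory Submission
  imports Defs
begin

text \<open>Adding one vertex at a time, \<open>P\<close> is mapped to the convex hull of \<open>P \<union> Q\<close> by a
  piecewise linear homeomorphism with positive Jacobians, and so is \<open>Q\<close>; hence \<open>P\<close> and \<open>Q\<close> are
  related by such a map.  Pulling \<open>\<omega>\<^sub>2\<close> back along it leaves two piecewise constant densities of
  equal total mass on \<open>P\<close>, both constant on the simplices of one triangulation of \<open>P\<close>.

  Mass can be moved between two simplices with a common facet by a homeomorphism that fixes the
  boundary of their union: unfold the union to a standard bipyramid and push the barycentre of the
  common facet along the axis until the density is uniform.  The uniform density depends only on
  the total mass, so this links all ways to distribute the mass on the two simplices.  The dual
  graph of a triangulation of a convex set is connected, so a sequence of such moves turns one
  distribution of masses into the other.\<close>

section \<open>Piecewise linear transport of densities\<close>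

text \<open>Up to affine charts, every explicit map here displaces points along one fixed direction
  by an amount that is affine on each piece. Its Jacobian is then 1 plus the slope of that amount in
  the same direction, so all volume bookkeeping reduces to slopes. Two obstacles shape the
  construction. Two simplices with a common facet may have a nonconvex union, and a move on them
  must fix the boundary of the union in order to extend by the identity; both are settled in a
  symmetric model whose halves have equal volume, reached by a shear of the far half. Moreover, an
  identity of forms is signed, so Jacobians must be positive. Charts may still reverse orientation,
  because they occur together with their inverses. The cells that witness a transport may overlap or
  be flat, which makes them stable under preimages and hence under composition. Genuine
  triangulations are built only where faces, volumes or integrals matter.\<close>

lemma det_row_replaced:
  fixes a l :: "real^'n"
  assumes "finite S" "k \<notin> S"
  shows "det (\<chi> i. if i = k then l else if i \<in> S then axis i 1 + (a$i) *s l else axis i 1) = l$k"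
  using assms
proof (induction S)
  case empty
  have eq: "transpose (\<chi> i j. if j = k then (mat 1 *v l)$i else (mat 1 :: real^'n^'n)$i$j)
      = (\<chi> i. if i = k then l else axis i 1)"
    unfolding matrix_vector_mul_lid by (auto simp: transpose_def vec_eq_iff mat_def axis_def)
  \<comment> \<open>Cramer's rule for the identity matrix: it concerns a replaced column, and
    transposing turns the column into a row.\<close>
  have "det (\<chi> i. if i = k then l else axis i 1) = l$k"
    using cramer_lemma[where A="mat 1 :: real^'n^'n" and k=k and x=l] unfolding eq[symmetric] det_transpose by simp
  then show ?case using empty by (simp only: empty_iff if_False)
next
  case (insert j S)
  let ?A = "(\<chi> i. if i = k then l else if i \<in> S then axis i 1 + (a$i) *s l else axis i 1) :: real^'n^'n"
  have jk: "j \<noteq> k" using insert by auto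
  have "(\<chi> i. if i = k then l else if i \<in> insert j S then axis i 1 + (a$i) *s l else axis i 1)
     = (\<chi> i. if i = j then row j ?A + (a$j) *s row k ?A else row i ?A)"
    using jk insert.hyps by (auto simp: vec_eq_iff row_def)
  then show ?case
    using det_row_operation[OF jk, of ?A "a$j"] insert by simp
qed

text \<open>The rows in \<open>S\<close> are perturbed one at a time. Row \<open>k\<close> splits by
  multilinearity: with \<open>axis k 1\<close> the induction hypothesis applies, and with
  \<open>a$k *s l\<close> this row sweeps out the multiples of \<open>l\<close> in the other rows,
  leaving \<open>a$k * l$k\<close>.\<close>

lemma det_identity_plus_rank_one_rows:
  fixes a l :: "real^'n"
  assumes "finite S"
  shows "det (\<chi> i. if i \<in> S then axis i 1 + (a$i) *s l else axis i 1) = 1 + (\<Sum>i\<in>S. a$i * l$i)"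
  using assms
proof (induction S)
  case empty
  have "(\<chi> i. axis i 1) = (mat 1 :: real^'n^'n)"
    by (auto simp: vec_eq_iff mat_def axis_def)
  then show ?case by simp
next
  case (insert k S)
  let ?r = "\<lambda>i. if i \<in> S then axis i 1 + (a$i) *s l else (axis i 1 :: real^'n)"
  have "(\<chi> i. if i \<in> insert k S then axis i 1 + (a$i) *s l else axis i 1)
     = (\<chi> i. if i = k then axis k 1 + (a$k) *s l else ?r i)"
    using insert.hyps by (auto simp: vec_eq_iff)
  also have "det \<dots> = det (\<chi> i. if i = k then axis k 1 else ?r i)
      + det (\<chi> i. if i = k then (a$k) *s l else ?r i)"
    using det_row_add[of k "\<lambda>_. axis k 1" "\<lambda>_. (a$k) *s l" ?r] by simp
  also have "(\<chi> i. if i = k then axis k 1 else ?r i) = (\<chi> i. ?r i)"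
    using insert.hyps by (auto simp: vec_eq_iff)
  also have "det (\<chi> i. if i = k then (a$k) *s l else ?r i) = a$k * l$k"
    using det_row_mul[of k "a$k" "\<lambda>_. l" ?r] det_row_replaced[OF insert.hyps, of l a] by simp
  finally show ?case using insert by simp
qed

text \<open>The matrix determinant lemma. For a map that displaces in direction \<open>a\<close> by
  an affine amount with gradient \<open>l\<close>, it yields the Jacobian without any matrix
  computation.\<close>

lemma det_identity_plus_rank_one:
  fixes a l :: "real^'n"
  shows "det (matrix (\<lambda>x. x + (l \<bullet> x) *\<^sub>R a)) = 1 + l \<bullet> a"
proof -
  have "matrix (\<lambda>x. x + (l \<bullet> x) *\<^sub>R a) = (\<chi> i. axis i 1 + (a$i) *s l)"
    unfolding vec_eq_iff by (simp add: matrix_def inner_axis) (simp add: axis_def)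
  then show ?thesis
    using det_identity_plus_rank_one_rows[of UNIV a l] by (simp add: inner_vec_def mult.commute)
qed

text \<open>The number \<open>\<sigma>\<close> only matters through its sign, which prescribes the orientation behaviour on
  all cells: affine charts of simplices may reverse the orientation.\<close>

definition PL_transport ::
  "real \<Rightarrow> (real^'n) set \<Rightarrow> (real^'n \<Rightarrow> real) \<Rightarrow> (real^'n) set \<Rightarrow> (real^'n \<Rightarrow> real) \<Rightarrow> (real^'n \<Rightarrow> real^'n) \<Rightarrow> bool"
  where "PL_transport \<sigma> P c Q e f \<longleftrightarrow> inj_on f P \<and> f ` P = Q \<and>
    (\<exists>D. finite D \<and> (\<forall>X\<in>D. polytope X) \<and> \<Union>D = P \<and>
      (\<forall>X\<in>D. \<exists>L b. linear L \<and> \<sigma> * det (matrix L) > 0 \<and> (\<forall>x\<in>X. f x = L x + b) \<and>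
         (\<forall>x\<in>interior X. \<bar>det (matrix L)\<bar> * e (f x) = c x)))"

section \<open>Composition and inversion of transports\<close>

lemma linear_det_nz_inverse:
  fixes L :: "real^'n \<Rightarrow> real^'n"
  assumes "linear L" "det (matrix L) \<noteq> 0"
  obtains M where "linear M" "\<And>x. M (L x) = x" "\<And>x. L (M x) = x" "det (matrix M) = inverse (det (matrix L))"
proof -
  have "inj L" using assms det_nz_iff_inj by blast
  then obtain M where M: "linear M" "M \<circ> L = id"
    using linear_injective_left_inverse assms by blast
  have "L \<circ> M = id"
    using M assms linear_inverse_left by blast
  moreover have "det (matrix M) * det (matrix L) = 1"
    using matrix_compose[OF assms(1) M(1)] M(2)
    by (metis det_I det_mul matrix_id_mat_1)
  ultimately show thesis
    using that[OF M(1)] M(2) by (metis comp_apply id_apply inverse_unique mult.commute)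
qed

lemma PL_transport_cong_sign:
  assumes "PL_transport \<sigma> P c Q e f" "\<sigma> * \<tau> > 0"
  shows "PL_transport \<tau> P c Q e f"
proof -
  have "\<sigma> * r > 0 \<longleftrightarrow> \<tau> * r > 0" for r :: real
    using assms(2) by (auto simp: zero_less_mult_iff)
  with assms(1) show ?thesis
    unfolding PL_transport_def by simp
qed

lemma polytope_affine_image:
  fixes L :: "real^'n \<Rightarrow> real^'n"
  assumes "linear L" "polytope X"
  shows "polytope ((\<lambda>x. L x + b) ` X)"
proof -
  have "(\<lambda>x. L x + b) ` X = (+) b ` (L ` X)"
    by (auto simp: image_image add.commute)
  then show ?thesis
    using assms polytope_linear_image polytope_translation_eq by metis
qed

lemma interior_affine_image:
  fixes L :: "real^'n \<Rightarrow> real^'n"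
  assumes "linear L" "det (matrix L) \<noteq> 0"
  shows "interior ((\<lambda>x. L x + b) ` X) = (\<lambda>x. L x + b) ` interior X"
proof -
  have eq: "(\<lambda>x. L x + b) ` Y = (+) b ` (L ` Y)" for Y
    by (auto simp: image_image add.commute)
  have "inj L" using assms det_nz_iff_inj by blast
  then show ?thesis
    unfolding eq using assms by (simp add: interior_translation interior_injective_linear_image)
qed

lemma PL_transport_id:
  fixes P :: "(real^'n) set"
  assumes "polytope P"
  shows "PL_transport 1 P c P c (\<lambda>x. x)"
proof -
  have "matrix (\<lambda>x. x) = (mat 1 :: real^'n^'n)"
    using matrix_id_mat_1 by (simp add: id_def)
  then have "\<exists>L b. linear L \<and> 1 * det (matrix L) > 0 \<and> (\<forall>x\<in>P. x = L x + b) \<and>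
      (\<forall>x\<in>interior P. \<bar>det (matrix L)\<bar> * c x = c x)"
    by (intro exI[of _ "\<lambda>x. x"] exI[of _ 0]) (simp add: linear_ident)
  then show ?thesis
    unfolding PL_transport_def using assms by (auto intro!: exI[of _ "{P}"])
qed

text \<open>The new pieces are the sets \<open>X \<inter> {x. f x \<in> Y}\<close>, on which both
  maps are affine. Determinants multiply, which chains the two density identities and accounts for
  the sign \<open>\<sigma> * \<tau>\<close>.\<close>

lemma PL_transport_comp:
  assumes f: "PL_transport \<sigma> P c Q e f" and g: "PL_transport \<tau> Q e R h g"
  shows "PL_transport (\<sigma> * \<tau>) P c R h (g \<circ> f)"
proof -
  obtain D where D: "finite D" "\<And>X. X\<in>D \<Longrightarrow> polytope X" "\<Union>D = P"
    "\<And>X. X\<in>D \<Longrightarrow> \<exists>L b. linear L \<and> \<sigma> * det (matrix L) > 0 \<and> (\<forall>x\<in>X. f x = L x + b) \<and>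
         (\<forall>x\<in>interior X. \<bar>det (matrix L)\<bar> * e (f x) = c x)"
    using f unfolding PL_transport_def by metis
  obtain E where E: "finite E" "\<And>X. X\<in>E \<Longrightarrow> polytope X" "\<Union>E = Q"
    "\<And>X. X\<in>E \<Longrightarrow> \<exists>L b. linear L \<and> \<tau> * det (matrix L) > 0 \<and> (\<forall>x\<in>X. g x = L x + b) \<and>
         (\<forall>x\<in>interior X. \<bar>det (matrix L)\<bar> * h (g x) = e x)"
    using g unfolding PL_transport_def by metis
  have fP: "f ` P = Q" "inj_on f P" and gQ: "g ` Q = R" "inj_on g Q"
    using f g unfolding PL_transport_def by auto
  let ?piece = "\<lambda>(X,Y). X \<inter> {x. f x \<in> Y}"
  have piece: "polytope (X \<inter> {x. f x \<in> Y}) \<and>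
     (\<exists>L b. linear L \<and> (\<sigma>*\<tau>) * det (matrix L) > 0 \<and> (\<forall>x\<in>X \<inter> {x. f x \<in> Y}. (g \<circ> f) x = L x + b) \<and>
         (\<forall>x\<in>interior (X \<inter> {x. f x \<in> Y}). \<bar>det (matrix L)\<bar> * h ((g\<circ>f) x) = c x))"
    if XY: "X \<in> D" "Y \<in> E" for X Y
  proof -
    obtain L b where L: "linear L" "\<sigma> * det (matrix L) > 0" "\<And>x. x\<in>X \<Longrightarrow> f x = L x + b"
         "\<And>x. x\<in>interior X \<Longrightarrow> \<bar>det (matrix L)\<bar> * e (f x) = c x" using D(4)[OF XY(1)] by blast
    obtain K a where K: "linear K" "\<tau> * det (matrix K) > 0" "\<And>x. x\<in>Y \<Longrightarrow> g x = K x + a"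
         "\<And>x. x\<in>interior Y \<Longrightarrow> \<bar>det (matrix K)\<bar> * h (g x) = e x" using E(4)[OF XY(2)] by blast
    have nz: "det (matrix L) \<noteq> 0" using L(2) by auto
    obtain M where M: "linear M" "\<And>x. M (L x) = x" "\<And>x. L (M x) = x"
      using linear_det_nz_inverse[OF L(1) nz] by metis
    \<comment> \<open>The preimage of \<open>Y\<close> under the affine map of \<open>X\<close> is
      the image of \<open>Y\<close> under the inverse affine map, hence a polytope.\<close>
    have img: "X \<inter> {x. f x \<in> Y} = X \<inter> (\<lambda>x. M x + (- M b)) ` Y"
    proof -
      have "f x \<in> Y \<longleftrightarrow> x \<in> (\<lambda>x. M x + (- M b)) ` Y" if "x \<in> X" for x
      proof
        assume "f x \<in> Y"
        moreover have "x = M (f x) + (- M b)"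
          using L(3)[OF that] M linear_add[OF M(1)] by simp
        ultimately show "x \<in> (\<lambda>x. M x + (- M b)) ` Y" by blast
      next
        assume "x \<in> (\<lambda>x. M x + (- M b)) ` Y"
        then obtain y where y: "y \<in> Y" "x = M y + (- M b)" by blast
        have "L x = y - b"
          using y M linear_diff[OF L(1)] by simp
        then show "f x \<in> Y" using L(3)[OF that] y by simp
      qed
      then show ?thesis by blast
    qed
    have poly: "polytope (X \<inter> {x. f x \<in> Y})"
      unfolding img using D(2) E(2) XY polytope_affine_image[OF M(1)] polytope_Int by blast
    have "linear (K \<circ> L)" using K(1) L(1) linear_compose by blast
    moreover have det: "det (matrix (K \<circ> L)) = det (matrix K) * det (matrix L)"
      by (simp add: matrix_compose[OF L(1) K(1)] det_mul)
    moreover have "(\<sigma>*\<tau>) * det (matrix (K \<circ> L)) > 0"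
      using mult_pos_pos[OF L(2) K(2)] unfolding det by (simp add: mult_ac)
    moreover have "(g \<circ> f) x = (K \<circ> L) x + (K b + a)" if "x\<in>X \<inter> {x. f x \<in> Y}" for x
      using that L(3)[of x] K(3)[of "f x"] linear_add[OF K(1)] by (simp add: algebra_simps)
    moreover have "\<bar>det (matrix (K\<circ>L))\<bar> * h ((g\<circ>f) x) = c x" if x: "x\<in>interior (X \<inter> {x. f x \<in> Y})" for x
    proof -
      have xX: "x \<in> interior X" using x interior_mono by blast
      have "f x = L x + b" using L(3) xX interior_subset by blast
      moreover have "L x + b \<in> (\<lambda>x. L x + b) ` interior (X \<inter> {x. f x \<in> Y})" using x by blast
      \<comment> \<open>An invertible affine map is open, so interior points of the piece land in
        \<open>interior Y\<close>, where the second density identity is available.\<close>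
      moreover have "(\<lambda>x. L x + b) ` interior (X \<inter> {x. f x \<in> Y}) \<subseteq> interior Y"
        unfolding interior_affine_image[OF L(1) nz, symmetric]
        by (rule interior_mono) (use L(3) in force)
      ultimately have "f x \<in> interior Y" by auto
      then show ?thesis
        using K(4) L(4)[OF xX] unfolding det abs_mult by (metis comp_apply mult.assoc mult.commute)
    qed
    ultimately show ?thesis using poly by blast
  qed
  have U: "\<Union>(?piece ` (D \<times> E)) = P"
    using D(3) E(3) fP(1) by fastforce
  show ?thesis
    unfolding PL_transport_def
  proof (intro conjI)
    show "inj_on (g \<circ> f) P" using fP gQ by (metis comp_inj_on)
    show "(g \<circ> f) ` P = R" using fP gQ by (metis image_comp)
    show "\<exists>D. finite D \<and> (\<forall>X\<in>D. polytope X) \<and> \<Union>D = P \<and>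
      (\<forall>X\<in>D. \<exists>L b. linear L \<and> \<sigma> * \<tau> * det (matrix L) > 0 \<and> (\<forall>x\<in>X. (g\<circ>f) x = L x + b) \<and>
         (\<forall>x\<in>interior X. \<bar>det (matrix L)\<bar> * h ((g\<circ>f) x) = c x))"
    proof (intro exI[of _ "?piece ` (D \<times> E)"] conjI)
      show "finite (?piece ` (D \<times> E))" using D E by simp
    qed (use piece U in auto)
  qed
qed

text \<open>The images of the cells serve as cells. Inverting a matrix keeps the sign of its
  determinant, so \<open>\<sigma>\<close> is unchanged while the densities trade places.\<close>

lemma PL_transport_inverse:
  assumes f: "PL_transport \<sigma> P c Q e f"
  shows "PL_transport \<sigma> Q e P c (the_inv_into P f)"
proof -
  obtain D where D: "finite D" "\<And>X. X\<in>D \<Longrightarrow> polytope X" "\<Union>D = P"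
    "\<And>X. X\<in>D \<Longrightarrow> \<exists>L b. linear L \<and> \<sigma> * det (matrix L) > 0 \<and> (\<forall>x\<in>X. f x = L x + b) \<and>
         (\<forall>x\<in>interior X. \<bar>det (matrix L)\<bar> * e (f x) = c x)"
    using f unfolding PL_transport_def by metis
  have fP: "f ` P = Q" "inj_on f P"
    using f unfolding PL_transport_def by auto
  let ?g = "the_inv_into P f"
  have gf: "?g (f x) = x" if "x \<in> P" for x
    using fP that by (simp add: the_inv_into_f_f)
  have piece: "polytope (f ` X) \<and>
     (\<exists>L b. linear L \<and> \<sigma> * det (matrix L) > 0 \<and> (\<forall>x\<in>f ` X. ?g x = L x + b) \<and>
         (\<forall>x\<in>interior (f ` X). \<bar>det (matrix L)\<bar> * c (?g x) = e x))" if X: "X \<in> D" for X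
  proof -
    obtain L b where L: "linear L" "\<sigma> * det (matrix L) > 0" "\<And>x. x\<in>X \<Longrightarrow> f x = L x + b"
         "\<And>x. x\<in>interior X \<Longrightarrow> \<bar>det (matrix L)\<bar> * e (f x) = c x" using D(4)[OF X(1)] by blast
    have nz: "det (matrix L) \<noteq> 0" using L(2) by auto
    obtain M where M: "linear M" "\<And>x. M (L x) = x" "\<And>x. L (M x) = x" "det (matrix M) = inverse (det (matrix L))"
      using linear_det_nz_inverse[OF L(1) nz] by metis
    have fX: "f ` X = (\<lambda>x. L x + b) ` X" using L(3) by auto
    have XP: "X \<subseteq> P" using D(3) X by blast
    have "polytope (f ` X)" unfolding fX using polytope_affine_image[OF L(1)] D(2) X by blast
    moreover have "\<sigma> * det (matrix M) > 0"
      using L(2) M(4) by (auto simp: zero_less_mult_iff)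
    moreover have "?g y = M y + (- M b)" if "y \<in> f ` X" for y
    proof -
      obtain x where x: "x \<in> X" "y = f x" using \<open>y \<in> f ` X\<close> by blast
      then show ?thesis
        using gf[of x] XP L(3)[OF x(1)] M linear_add[OF M(1)] by auto
    qed
    moreover have "\<bar>det (matrix M)\<bar> * c (?g y) = e y" if y: "y \<in> interior (f ` X)" for y
    proof -
      obtain x where x: "x \<in> interior X" "y = L x + b"
        using y unfolding fX interior_affine_image[OF L(1) nz] by blast
      then have "x \<in> X" "y = f x" using interior_subset L(3) by (blast, metis interior_subset subsetD)
      then have "?g y = x" using gf XP by auto
      then show ?thesis
        using L(4)[OF x(1)] nz \<open>y = f x\<close> unfolding M(4) by (simp add: field_simps)
    qed
    ultimately show ?thesis using M(1) by blast
  qed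
  show ?thesis
    unfolding PL_transport_def
  proof (intro conjI)
    show "inj_on ?g Q" using fP by (metis inj_on_the_inv_into)
    show "?g ` Q = P" using fP by (metis the_inv_into_onto)
    show "\<exists>D. finite D \<and> (\<forall>X\<in>D. polytope X) \<and> \<Union>D = Q \<and>
      (\<forall>X\<in>D. \<exists>L b. linear L \<and> \<sigma> * det (matrix L) > 0 \<and> (\<forall>x\<in>X. ?g x = L x + b) \<and>
         (\<forall>x\<in>interior X. \<bar>det (matrix L)\<bar> * c (?g x) = e x))"
      by (intro exI[of _ "(`) f ` D"]) (use piece D fP in auto)
  qed
qed

section \<open>The standard bipyramid\<close>

lemma polyhedron_Int_halfspaces:
  fixes a :: "'i \<Rightarrow> 'a::euclidean_space"
  assumes "finite I"
  shows "polyhedron {x. \<forall>i\<in>I. a i \<bullet> x \<le> b i}"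
proof -
  have "{x. \<forall>i\<in>I. a i \<bullet> x \<le> b i} = (\<Inter>i\<in>I. {x. a i \<bullet> x \<le> b i})" by auto
  then show ?thesis
    using assms by (auto intro!: polyhedron_Inter polyhedron_halfspace_le)
qed

definition ones :: "real^'n" where
  "ones = (\<chi> i. 1)"

definition min_coord :: "real^'n \<Rightarrow> real" where
  "min_coord x = Min (range (($) x))"

text \<open>Since \<open>ones \<bullet> ones\<close> equals \<open>real CARD('n)\<close>, this
  factor makes the subtraction of \<open>excess x *\<^sub>R ones\<close> the orthogonal reflection
  in the hyperplane \<open>ones \<bullet> x = 1\<close>.\<close>

definition excess :: "real^'n \<Rightarrow> real" where
  "excess x = 2 / real CARD('n) * (ones \<bullet> x - 1)"

definition std_cell :: "(real^'n) set" where
  "std_cell = {x. (\<forall>i. 0 \<le> x$i) \<and> ones \<bullet> x \<le> 1}"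

definition mirror :: "real^'n \<Rightarrow> real^'n" where
  "mirror x = x - excess x *\<^sub>R ones"

definition mirror_cell :: "(real^'n) set" where
  "mirror_cell = {x. (\<forall>i. excess x \<le> x$i) \<and> 1 \<le> ones \<bullet> x}"

text \<open>As \<open>mirror\<close> lowers every coordinate by \<open>excess x\<close>, the second
  entry is the smallest coordinate of \<open>mirror x\<close>; the formula is symmetric under the
  reflection.\<close>

definition tent :: "real^'n \<Rightarrow> real" where
  "tent x = min (min_coord x) (min_coord x - excess x)"

text \<open>The bipyramid consists of \<open>std_cell\<close> and its mirror image in the facet spanned by the standard
  basis.  On it \<open>tent\<close> vanishes exactly on the boundary, and it is linear on each simplex spanned
  by an apex, the barycentre of the common facet and a facet of the latter.\<close>

definition bipyramid :: "(real^'n) set" where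
  "bipyramid = {x. 0 \<le> tent x}"

lemma ones_nth [simp]: "ones $ i = 1"
  by (simp add: ones_def)

lemma inner_ones: "ones \<bullet> (x::real^'n) = (\<Sum>i\<in>UNIV. x$i)"
  by (simp add: inner_vec_def)

lemma inner_ones_ones: "ones \<bullet> (ones::real^'n) = real CARD('n)"
  by (simp add: inner_ones)

lemma excess_add_ones: "excess (x + t *\<^sub>R ones) = excess x + 2 * t"
  by (simp add: excess_def inner_add_right inner_ones_ones field_simps)

lemma excess_le_0_iff: "excess x \<le> 0 \<longleftrightarrow> ones \<bullet> x \<le> 1"
  unfolding excess_def mult_le_0_iff by auto

lemma excess_ge_0_iff: "0 \<le> excess x \<longleftrightarrow> 1 \<le> ones \<bullet> x"
  unfolding excess_def zero_le_mult_iff by auto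

lemma excess_mirror: "excess (mirror x) = - excess x"
  using excess_add_ones[of x "- excess x"] by (simp add: mirror_def)

lemma mirror_mirror: "mirror (mirror x) = x"
proof -
  have "mirror (mirror x) = mirror x - excess (mirror x) *\<^sub>R ones" by (simp only: mirror_def)
  then show ?thesis by (simp add: excess_mirror) (simp add: mirror_def)
qed

lemma min_coord_add_ones:
  fixes x :: "real^'n"
  shows "min_coord (x + t *\<^sub>R ones) = min_coord x + t"
proof -
  have "range (($) (x + t *\<^sub>R ones)) = (\<lambda>y. y + t) ` range (($) x)"
    by (auto simp: image_image)
  moreover have "Min ((\<lambda>y. y + t) ` range (($) x)) = Min (range (($) x)) + t"
    by (subst mono_Min_commute[symmetric]) (auto intro!: monoI)
  ultimately show ?thesis by (simp add: min_coord_def)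
qed

lemma min_coord_ge_iff: "a \<le> min_coord x \<longleftrightarrow> (\<forall>i. a \<le> x$i)"
  by (auto simp: min_coord_def)

lemma min_coord_eqI: "(\<And>i. x$j \<le> x$i) \<Longrightarrow> min_coord x = x$j"
  unfolding min_coord_def by (rule Min_eqI) auto

lemma min_coord_attained:
  fixes x :: "real^'n"
  obtains j where "\<And>i. x$j \<le> x$i"
proof -
  have "min_coord x \<in> range (($) x)" unfolding min_coord_def by (rule Min_in) auto
  then obtain j where "min_coord x = x$j" by auto
  then show thesis using that[of j] min_coord_ge_iff[of "min_coord x" x] by auto
qed

lemma std_cell_iff: "x \<in> std_cell \<longleftrightarrow> x \<in> bipyramid \<and> ones \<bullet> x \<le> 1"
  using excess_le_0_iff[of x] min_coord_ge_iff[of 0 x]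
  by (auto simp: std_cell_def bipyramid_def tent_def)

lemma mirror_cell_iff: "x \<in> mirror_cell \<longleftrightarrow> x \<in> bipyramid \<and> 1 \<le> ones \<bullet> x"
  using excess_ge_0_iff[of x] min_coord_ge_iff[of "excess x" x]
  by (auto simp: mirror_cell_def bipyramid_def tent_def)

lemma bipyramid_eq: "bipyramid = std_cell \<union> mirror_cell"
  using std_cell_iff mirror_cell_iff linear by blast

lemma mirror_image_std_cell: "mirror ` std_cell = (mirror_cell :: (real^'n) set)"
proof -
  have "x \<in> mirror_cell \<longleftrightarrow> mirror x \<in> std_cell" for x :: "real^'n"
    using excess_mirror[of x] excess_ge_0_iff[of x] excess_le_0_iff[of "mirror x"]
    by (auto simp: mirror_cell_def std_cell_def mirror_def)
  then show ?thesis using mirror_mirror by (metis (no_types, opaque_lifting) image_eqI image_subsetI subsetI subset_antisym)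
qed

lemma axis_le_ones: "ones \<bullet> axis i (1::real) = 1"
  by (simp add: inner_axis)

lemma std_cell_hull: "std_cell = convex hull (insert 0 (range (\<lambda>i. axis i (1::real))) :: (real^'n) set)"
proof -
  have B: "(Basis :: (real^'n) set) = range (\<lambda>i. axis i 1)"
    by (auto simp: Basis_vec_def)
  have "inj (\<lambda>i::'n. axis i (1::real))" by (auto simp: inj_def axis_eq_axis)
  then have "sum (\<lambda>i. x \<bullet> i) (Basis::(real^'n) set) = ones \<bullet> x" for x :: "real^'n"
    unfolding B by (simp add: sum.reindex inner_axis inner_ones)
  then show ?thesis
    unfolding B[symmetric] std_simplex by (auto simp: std_cell_def B inner_axis)
qed

lemma mirror_affine:
  obtains L :: "real^'n \<Rightarrow> real^'n" and b where "linear L" "det (matrix L) = -1" "mirror = (\<lambda>x. L x + b)"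
proof -
  let ?l = "(- 2 / real CARD('n)) *\<^sub>R (ones :: real^'n)"
  have "det (matrix (\<lambda>x. x + (?l \<bullet> x) *\<^sub>R ones)) = -1"
    unfolding det_identity_plus_rank_one by (simp add: inner_ones_ones)
  moreover have "linear (\<lambda>x. x + (?l \<bullet> x) *\<^sub>R ones)"
    by (rule linearI) (simp_all add: algebra_simps inner_add_right)
  moreover have "mirror = (\<lambda>x. (x + (?l \<bullet> x) *\<^sub>R ones) + (2 / real CARD('n)) *\<^sub>R ones)"
    by (auto simp: mirror_def excess_def algebra_simps diff_divide_distrib)
  ultimately show thesis using that by blast
qed

lemma polytope_std_cell: "polytope (std_cell :: (real^'n) set)"
  unfolding std_cell_hull by (rule polytope_convex_hull) simp

lemma polytope_mirror_cell: "polytope (mirror_cell :: (real^'n) set)"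
proof -
  obtain L :: "real^'n \<Rightarrow> real^'n" and b where L: "linear L" "mirror = (\<lambda>x. L x + b)"
    by (rule mirror_affine)
  then show ?thesis
    unfolding mirror_image_std_cell[symmetric] L(2) using polytope_affine_image polytope_std_cell by blast
qed

section \<open>Lebesgue measure of affine images\<close>

lemma lmeasurable_polytope: "polytope X \<Longrightarrow> X \<in> lmeasurable"
  by (simp add: lmeasurable_compact polytope_imp_compact)

text \<open>The library has this formula only for well-ordered index types.\<close>

lemma measure_linear_image_finite:
  fixes f :: "real^'n \<Rightarrow> real^'n"
  assumes "linear f" "S \<in> lmeasurable"
  shows "f ` S \<in> lmeasurable \<and> measure lebesgue (f ` S) = \<bar>det (matrix f)\<bar> * measure lebesgue S"
proof -
  define Q where "Q f \<longleftrightarrow> (\<forall>S\<in>lmeasurable. f ` S \<in> lmeasurable \<and>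
      measure lebesgue (f ` S) = \<bar>det (matrix f)\<bar> * measure lebesgue S)" for f :: "real^'n \<Rightarrow> real^'n"
  have comp: "Q (f \<circ> g)" if "linear f" "linear g" "Q f" "Q g" for f g
  proof -
    have "(f \<circ> g) ` S = f ` (g ` S)" for S by auto
    then show ?thesis
      using that unfolding Q_def by (simp only: matrix_compose det_mul abs_mult) simp
  qed
  have stretch: "Q (\<lambda>x. \<chi> i. c i * x$i)" for c
    unfolding Q_def
    using measurable_stretch measure_stretch by (auto simp: axis_def matrix_def det_diagonal)
  have shear: "Q (\<lambda>x. \<chi> i. if i = m then x$m + x$n else x$i)" if "m \<noteq> n" for m n :: 'n
  proof -
    let ?h = "\<lambda>x::real^'n. \<chi> i. if i = m then x$m + x$n else x$i"
    have h: "?h = (\<lambda>x. x + (axis n 1 \<bullet> x) *\<^sub>R axis m 1)"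
      by (simp add: fun_eq_iff vec_eq_iff inner_axis') (auto simp: axis_def)
    have lin: "linear ?h"
      unfolding h by (rule linearI) (simp_all add: algebra_simps inner_add_right)
    have det: "det (matrix ?h) = 1"
      unfolding h det_identity_plus_rank_one using that by (simp add: inner_axis_axis)
    have "measure lebesgue (?h ` cbox a b) = 1 * measure lebesgue (cbox a b)" for a b
    proof (cases "cbox a b = {}")
      case False
      \<comment> \<open>Translating the box to the origin provides the nonnegative lower corner that
        \<open>measure_shear_interval\<close> asks for.\<close>
      have box: "cbox a b = (+) a ` cbox 0 (b - a)"
        using cbox_translation[of a 0 "b - a"] by simp
      have "?h ` cbox a b = (+) (?h a) ` ?h ` cbox 0 (b - a)"
        unfolding box image_image using linear_add[OF lin] by auto
      then have "measure lebesgue (?h ` cbox a b) = measure lebesgue (?h ` cbox 0 (b - a))"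
        by (simp only: measure_translation)
      also have "\<dots> = measure lebesgue (cbox 0 (b - a))"
        using measure_shear_interval[OF that, of 0 "b - a"] False box by auto
      also have "\<dots> = measure lebesgue (cbox a b)"
        unfolding box measure_translation ..
      finally show ?thesis by simp
    qed simp
    then have "?h ` S \<in> lmeasurable \<and> measure lebesgue (?h ` S) = \<bar>1\<bar> * measure lebesgue S" if "S \<in> lmeasurable" for S
      using measure_linear_sufficient[OF lin that] by (metis abs_one)
    then show ?thesis unfolding Q_def det by blast
  qed
  have swap: "Q (\<lambda>x. \<chi> i. x $ Transposition.transpose m n i)" if "m \<noteq> n" for m n :: 'n
  proof -
    let ?h = "\<lambda>m n. \<lambda>x::real^'n. \<chi> i. if i = m then x$m + x$n else x$i"
    let ?s = "\<lambda>m. \<lambda>x::real^'n. \<chi> i. (if i = m then -1 else 1) * x$i"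
    have lh: "linear (?h m n)" for m n
      by (rule linearI) (auto simp: vec_eq_iff algebra_simps)
    have ls: "linear (?s m)" for m
      by (rule linearI) (auto simp: vec_eq_iff algebra_simps)
    \<comment> \<open>Read from the right, the factors lead from \<open>(s, t)\<close> in the
      coordinates \<open>m\<close> and \<open>n\<close> to \<open>(s + t, t)\<close>,
      \<open>(- s - t, t)\<close>, \<open>(- s - t, - s)\<close>, \<open>(s + t, - s)\<close>,
      \<open>(t, - s)\<close> and \<open>(t, s)\<close>. So swaps are covered by shears and
      stretches.\<close>
    have eq: "(\<lambda>x. \<chi> i. x $ Transposition.transpose m n i)
        = ?s n \<circ> (?h m n \<circ> (?s m \<circ> (?h n m \<circ> (?s m \<circ> ?h m n))))"
      using that by (auto simp: fun_eq_iff vec_eq_iff Transposition.transpose_def)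
    show ?thesis
      unfolding eq using that by (intro comp linear_compose lh ls stretch shear) auto
  qed
  have "Q f"
    using assms(1)
  proof (rule induct_linear_elementary)
    show "Q f" if f: "linear f" "\<And>x. f x $ i = 0" for f i
    proof -
      have "\<not> inj f"
      proof
        assume "inj f"
        then have "surj f" using linear_injective_imp_surjective[OF f(1)] by simp
        then obtain x where "f x = axis i 1" by (metis surj_def)
        then show False using f(2)[of x] by (simp add: axis_def)
      qed
      then have "det (matrix f) = 0" "negligible (f ` S)" for S
        using f(1) det_nz_iff_inj negligible_linear_singular_image by blast+
      then show ?thesis
        unfolding Q_def by (simp add: negligible_imp_measurable negligible_imp_measure0)
    qed
  qed (assumption | rule comp stretch swap shear)+
  then show ?thesis using assms(2) unfolding Q_def by blast
qed

lemma measure_affine_image: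
  fixes L :: "real^'n \<Rightarrow> real^'n"
  assumes "linear L" "polytope X"
  shows "measure lebesgue ((\<lambda>x. L x + b) ` X) = \<bar>det (matrix L)\<bar> * measure lebesgue X"
proof -
  have "(\<lambda>x. L x + b) ` X = (+) b ` (L ` X)"
    by (auto simp: image_image add.commute)
  then show ?thesis
    using measure_linear_image_finite[OF assms(1) lmeasurable_polytope[OF assms(2)]] measure_translation[of b "L ` X"] by simp
qed

lemma measure_mirror_cell: "measure lebesgue (mirror_cell :: (real^'n) set) = measure lebesgue (std_cell :: (real^'n) set)"
proof -
  obtain L :: "real^'n \<Rightarrow> real^'n" and b
    where L: "linear L" "det (matrix L) = -1" "mirror = (\<lambda>x. L x + b)"
    by (rule mirror_affine)
  show ?thesis
    unfolding mirror_image_std_cell[symmetric] L(3)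
    using measure_affine_image[OF L(1) polytope_std_cell, of b] L(2) by simp
qed

section \<open>Pushing along the axis of the bipyramid\<close>

lemma interior_le_hyperplane:
  fixes a :: "'a::euclidean_space"
  assumes "a \<noteq> 0" "x \<in> interior X" "\<And>y. y \<in> X \<Longrightarrow> a \<bullet> y \<le> b"
  shows "a \<bullet> x < b"
proof -
  have "interior X \<subseteq> interior {y. a \<bullet> y \<le> b}" using assms(3) by (intro interior_mono) auto
  then show ?thesis using assms by (auto simp: interior_halfspace_le)
qed

lemma ones_nonzero: "ones \<noteq> (0 :: real^'n)"
  by (auto simp: vec_eq_iff)

lemma interior_ge_hyperplane:
  fixes a :: "'a::euclidean_space"
  assumes "a \<noteq> 0" "x \<in> interior X" "\<And>y. y \<in> X \<Longrightarrow> b \<le> a \<bullet> y"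
  shows "b < a \<bullet> x"
  using interior_le_hyperplane[of "-a" x X "-b"] assms by auto

text \<open>On the bipyramid \<open>tent\<close> peaks at the barycentre of the common facet, so
  this point moves farthest; a positive \<open>k\<close> pushes away from the apex \<open>0\<close>,
  towards the apex of \<open>mirror_cell\<close>.\<close>

definition tent_shift :: "real \<Rightarrow> real^'n \<Rightarrow> real^'n" where
  "tent_shift k x = x + (k * tent x) *\<^sub>R ones"

lemma tent_add_ones:
  "tent (x + t *\<^sub>R ones) = min (min_coord x + t) (min_coord x - excess x - t)"
  by (simp add: tent_def min_coord_add_ones excess_add_ones)

lemma min_quotients:
  fixes k :: real
  assumes "0 < 1 + k" "0 < 1 - k"
  shows "min (u / (1 + k)) (v / (1 - k)) = r \<longleftrightarrow> min (u - k * r) (v + k * r) = r"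
proof -
  have *: "min a b = r \<longleftrightarrow> r \<le> a \<and> r \<le> b \<and> (r = a \<or> r = b)" for a b :: real by auto
  have "r \<le> u / (1 + k) \<longleftrightarrow> r \<le> u - k * r" "r = u / (1 + k) \<longleftrightarrow> r = u - k * r"
    "r \<le> v / (1 - k) \<longleftrightarrow> r \<le> v + k * r" "r = v / (1 - k) \<longleftrightarrow> r = v + k * r"
    using assms by (auto simp: field_simps)
  then show ?thesis unfolding * by simp
qed

text \<open>With \<open>r = tent x\<close>, and \<open>u\<close> and \<open>v\<close> the two
  entries of \<open>tent y\<close>, the equation becomes
  \<open>r = min (u - k * r) (v + k * r)\<close>. By \<open>min_quotients\<close> each branch may be
  solved for \<open>r\<close> separately. The explicit inverse on the whole space gives injectivity
  and surjectivity together.\<close>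

lemma tent_shift_unique:
  fixes x y :: "real^'n"
  assumes k: "\<bar>k\<bar> < 1"
  shows "tent_shift k x = y \<longleftrightarrow>
    x = y - (k * min (min_coord y / (1 + k)) ((min_coord y - excess y) / (1 - k))) *\<^sub>R ones"
    (is "_ \<longleftrightarrow> x = y - (k * ?r y) *\<^sub>R ones")
proof
  have pos: "1 + k > 0" "1 - k > 0" using k by auto
  assume "tent_shift k x = y"
  then have y: "y = x + (k * tent x) *\<^sub>R ones" by (simp add: tent_shift_def)
  have m: "min_coord y = min_coord x + k * tent x" "min_coord y - excess y = min_coord x - excess x - k * tent x"
    unfolding y min_coord_add_ones excess_add_ones by auto
  have "?r y = tent x"
    unfolding min_quotients[OF pos] using m by (simp only: tent_def)
  then show "x = y - (k * ?r y) *\<^sub>R ones" using y by simp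
next
  have pos: "1 + k > 0" "1 - k > 0" using k by auto
  assume x: "x = y - (k * ?r y) *\<^sub>R ones"
  have "tent x = min (min_coord y - k * ?r y) (min_coord y - excess y + k * ?r y)"
    unfolding x using tent_add_ones[of y "- (k * ?r y)"] by simp
  also have "\<dots> = ?r y"
    using min_quotients[OF pos, of "min_coord y" "min_coord y - excess y" "?r y"] by blast
  finally show "tent_shift k x = y" unfolding tent_shift_def using x by simp
qed

text \<open>The two entries of the new \<open>tent\<close> are at least
  \<open>(1 + k) * tent x\<close> and \<open>(1 - k) * tent x\<close>, with equality in at least one
  of them. Both factors are positive, so the sign survives and \<open>bipyramid\<close> is
  invariant.\<close>

lemma tent_tent_shift: 
  assumes "\<bar>k\<bar> < 1"
  shows "0 \<le> tent (tent_shift k x) \<longleftrightarrow> 0 \<le> tent x"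
proof -
  have pos: "1 + k > 0" "1 - k > 0" using assms by auto
  have "tent (tent_shift k x) = min (min_coord x + k * tent x) (min_coord x - excess x - k * tent x)"
    unfolding tent_shift_def tent_add_ones by simp
  moreover have "min_coord x + k * tent x \<ge> (1 + k) * tent x" "min_coord x - excess x - k * tent x \<ge> (1 - k) * tent x"
    by (auto simp: tent_def algebra_simps)
  moreover have "min_coord x + k * tent x = (1 + k) * tent x \<or> min_coord x - excess x - k * tent x = (1 - k) * tent x"
    by (auto simp: tent_def min_def algebra_simps)
  ultimately show ?thesis using pos by (smt (verit) mult_nonneg_nonneg mult_pos_neg)
qed

text \<open>On the cone \<open>?C j\<close> the minimal coordinate is \<open>x$j\<close>, which has
  slope 1 along \<open>ones\<close>; beyond the common facet \<open>excess\<close> contributes -2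
  and turns the slope into -1. Hence the Jacobian is \<open>1 + k\<close> on one half and
  \<open>1 - k\<close> on the other, whatever \<open>j\<close> is.\<close>

lemma PL_transport_tent_shift:
  fixes c :: "real^'n \<Rightarrow> real"
  assumes k: "\<bar>k\<bar> < 1"
    and c1: "\<And>x. ones \<bullet> x < 1 \<Longrightarrow> c x = (1 + k) * \<delta>"
    and c2: "\<And>x. ones \<bullet> x > 1 \<Longrightarrow> c x = (1 - k) * \<delta>"
  shows "PL_transport 1 bipyramid c bipyramid (\<lambda>_. \<delta>) (tent_shift k)"
proof -
  let ?C = "\<lambda>j. {x. \<forall>i\<in>UNIV. (axis j (1::real) - axis i 1) \<bullet> x \<le> 0} :: (real^'n) set"
  have C: "x \<in> ?C j \<longleftrightarrow> (\<forall>i. x$j \<le> x$i)" for x j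
    by (simp add: inner_diff_left inner_axis')
  let ?D = "range (\<lambda>j. std_cell \<inter> ?C j) \<union> range (\<lambda>j. mirror_cell \<inter> ?C j)"
  have polyC: "polyhedron (?C j)" for j
    by (rule polyhedron_Int_halfspaces) simp
  have lin: "linear (\<lambda>x. x + (l \<bullet> x) *\<^sub>R a)" for l a :: "real^'n"
    by (rule linearI) (simp_all add: algebra_simps inner_add_right)
  have lower: "\<exists>L b. linear L \<and> 1 * det (matrix L) > 0 \<and> (\<forall>x\<in>X. tent_shift k x = L x + b) \<and>
         (\<forall>x\<in>interior X. \<bar>det (matrix L)\<bar> * \<delta> = c x)" if X: "X = std_cell \<inter> ?C j" for X j
  proof -
    let ?L = "\<lambda>x::real^'n. x + (axis j 1 \<bullet> x) *\<^sub>R (k *\<^sub>R ones)"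
    have det: "det (matrix ?L) = 1 + k"
      unfolding det_identity_plus_rank_one by (simp add: inner_axis')
    have "tent_shift k x = ?L x + 0" if "x \<in> X" for x
    proof -
      have "min_coord x = x$j" using that X C min_coord_eqI by blast
      moreover have "excess x \<le> 0" using that X by (auto simp: std_cell_def excess_le_0_iff)
      ultimately show ?thesis by (simp add: tent_shift_def tent_def inner_axis')
    qed
    moreover have "\<bar>det (matrix ?L)\<bar> * \<delta> = c x" if "x \<in> interior X" for x
    proof -
      have "ones \<bullet> x < 1"
        by (rule interior_le_hyperplane[OF ones_nonzero that]) (auto simp: X std_cell_def)
      then show ?thesis using c1 k det by simp
    qed
    ultimately show ?thesis using lin[of "axis j 1" "k *\<^sub>R ones"] k det
      by (intro exI[of _ ?L] exI[of _ 0] conjI) auto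
  qed
  have upper: "\<exists>L b. linear L \<and> 1 * det (matrix L) > 0 \<and> (\<forall>x\<in>X. tent_shift k x = L x + b) \<and>
         (\<forall>x\<in>interior X. \<bar>det (matrix L)\<bar> * \<delta> = c x)" if X: "X = mirror_cell \<inter> ?C j" for X j
  proof -
    let ?l = "axis j 1 - (2 / real CARD('n)) *\<^sub>R ones"
    let ?L = "\<lambda>x::real^'n. x + (?l \<bullet> x) *\<^sub>R (k *\<^sub>R ones)"
    let ?b = "(k * (2 / real CARD('n))) *\<^sub>R ones"
    have det: "det (matrix ?L) = 1 - k"
      unfolding det_identity_plus_rank_one by (simp add: inner_axis' inner_diff_left inner_ones_ones)
    have "tent_shift k x = ?L x + ?b" if "x \<in> X" for x
    proof -
      have "min_coord x = x$j" using that X C min_coord_eqI by blast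
      moreover have "excess x \<ge> 0" using that X by (auto simp: mirror_cell_def excess_ge_0_iff)
      ultimately have "tent x = ?l \<bullet> x + 2 / real CARD('n)"
        by (simp add: tent_def inner_axis' inner_diff_left) (simp add: excess_def algebra_simps diff_divide_distrib)
      then show ?thesis
        by (simp only: tent_shift_def scaleR_scaleR distrib_left scaleR_left_distrib add.assoc mult.commute)
    qed
    moreover have "\<bar>det (matrix ?L)\<bar> * \<delta> = c x" if "x \<in> interior X" for x
    proof -
      have "ones \<bullet> x > 1"
        by (rule interior_ge_hyperplane[OF ones_nonzero that]) (auto simp: X mirror_cell_def)
      then show ?thesis using c2 k det by simp
    qed
    ultimately show ?thesis using lin[of ?l "k *\<^sub>R ones"] k det
      by (intro exI[of _ ?L] exI[of _ ?b] conjI) auto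
  qed
  have U: "\<Union>?D = bipyramid"
  proof -
    have "\<exists>j. x \<in> ?C j" for x :: "real^'n"
    proof -
      obtain j where "\<And>i. x$j \<le> x$i" using min_coord_attained[of x] by blast
      then show ?thesis unfolding C by blast
    qed
    then have "(\<Union>j. ?C j) = UNIV" by blast
    then show ?thesis
      by (simp only: bipyramid_eq Union_Un_distrib Int_UN_distrib[symmetric] Int_UNIV_right)
  qed
  show ?thesis
    unfolding PL_transport_def
  proof (intro conjI exI[of _ ?D])
    show "inj_on (tent_shift k) (bipyramid :: (real^'n) set)"
    proof (rule inj_onI)
      fix x y :: "real^'n" assume "tent_shift k x = tent_shift k y"
      then show "x = y"
        using tent_shift_unique[OF k, of x "tent_shift k y"] tent_shift_unique[OF k, of y "tent_shift k y"] by simp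
    qed
    show "tent_shift k ` bipyramid = (bipyramid :: (real^'n) set)"
    proof -
      have "y \<in> tent_shift k ` bipyramid" if y: "y \<in> bipyramid" for y :: "real^'n"
      proof -
        obtain x where "tent_shift k x = y" using tent_shift_unique[OF k] by blast
        then show ?thesis using y tent_tent_shift[OF k, of x] by (auto simp: bipyramid_def)
      qed
      then show ?thesis using tent_tent_shift[OF k] by (auto simp: bipyramid_def)
    qed
    show "\<forall>X\<in>?D. polytope X"
      using polytope_Int_polyhedron[OF polytope_std_cell polyC] polytope_Int_polyhedron[OF polytope_mirror_cell polyC]
      by blast
    show "\<forall>X\<in>?D. \<exists>L b. linear L \<and> 1 * det (matrix L) > 0 \<and> (\<forall>x\<in>X. tent_shift k x = L x + b) \<and>
         (\<forall>x\<in>interior X. \<bar>det (matrix L)\<bar> * \<delta> = c x)"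
      using lower upper by blast
  qed (use U in auto)
qed

lemma PL_transport_inj_on: "PL_transport \<sigma> P c Q e f \<Longrightarrow> inj_on f P"
  unfolding PL_transport_def by (elim conjE)

lemma PL_transport_image: "PL_transport \<sigma> P c Q e f \<Longrightarrow> f ` P = Q"
  unfolding PL_transport_def by (elim conjE)

lemma PL_transport_bipyramid:
  fixes c c' :: "real^'n \<Rightarrow> real"
  assumes pos: "\<alpha> > 0" "\<beta> > 0" "\<alpha>' > 0" "\<beta>' > 0" and sum: "\<alpha> + \<beta> = \<alpha>' + \<beta>'"
    and c: "\<And>x. ones \<bullet> x < 1 \<Longrightarrow> c x = \<alpha>" "\<And>x. ones \<bullet> x > 1 \<Longrightarrow> c x = \<beta>"
    and c': "\<And>x. ones \<bullet> x < 1 \<Longrightarrow> c' x = \<alpha>'" "\<And>x. ones \<bullet> x > 1 \<Longrightarrow> c' x = \<beta>'"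
  obtains f where "PL_transport 1 bipyramid c bipyramid c' f"
    "\<And>x. x \<in> bipyramid \<Longrightarrow> tent x = 0 \<Longrightarrow> f x = x"
proof -
  \<comment> \<open>The halves have equal volume, so the uniform density of the same mass is the
    average. Then \<open>k\<close> solves \<open>(1 + k) * \<delta> = \<alpha>\<close> and
    \<open>(1 - k) * \<delta> = \<beta>\<close>, and positive densities give
    \<open>\<bar>k\<bar> < 1\<close>.\<close>
  define \<delta> where "\<delta> = (\<alpha> + \<beta>) / 2"
  define k where "k = (\<alpha> - \<beta>) / (\<alpha> + \<beta>)"
  define k' where "k' = (\<alpha>' - \<beta>') / (\<alpha>' + \<beta>')"
  have \<delta>': "\<delta> = (\<alpha>' + \<beta>') / 2" using sum \<delta>_def by simp
  have k: "\<bar>k\<bar> < 1" "\<bar>k'\<bar> < 1" using pos by (auto simp: k_def k'_def abs_if field_simps)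
  have "(1 + k) * \<delta> = \<alpha>" "(1 - k) * \<delta> = \<beta>" using pos by (auto simp: k_def \<delta>_def field_simps)
  then have g: "PL_transport 1 bipyramid c bipyramid (\<lambda>_. \<delta>) (tent_shift k)"
    using c by (intro PL_transport_tent_shift k) auto
  have "(1 + k') * \<delta> = \<alpha>'" "(1 - k') * \<delta> = \<beta>'" using pos by (auto simp: k'_def \<delta>' field_simps)
  then have g': "PL_transport 1 bipyramid c' bipyramid (\<lambda>_. \<delta>) (tent_shift k')"
    using c' by (intro PL_transport_tent_shift k) auto
  have fix': "the_inv_into bipyramid (tent_shift k') x = x" if "x \<in> bipyramid" "tent x = 0" for x :: "real^'n"
  proof -
    from the_inv_into_f_f[OF PL_transport_inj_on[OF g'] that(1)] show ?thesis using that(2) by (simp add: tent_shift_def)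
  qed
  show thesis
    using that[OF PL_transport_comp[OF g PL_transport_inverse[OF g'], simplified]] fix'
    by (simp add: tent_shift_def)
qed

text \<open>The vector \<open>z\<close> records how the far apex deviates from the mirror image of
  the near one; the shear along it fixes the common facet, where
  \<open>ones \<bullet> x = 1\<close>. The bound \<open>ones \<bullet> z > -1\<close> says that the
  far apex stays beyond that facet, which keeps the unfolding injective even if
  \<open>S \<union> T\<close> is not convex.\<close>

lemma PL_transport_adjacent:
  fixes M :: "real^'n \<Rightarrow> real^'n" and z a :: "real^'n"
  defines "A \<equiv> (\<lambda>x. M x + a)"
  defines "S \<equiv> A ` std_cell" and "T \<equiv> (\<lambda>x. A (x + (ones \<bullet> x - 1) *\<^sub>R z)) ` mirror_cell"
  assumes M: "linear M" "det (matrix M) \<noteq> 0" and z: "ones \<bullet> z > -1"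
    and pos: "k > 0" "l > 0" "k' > 0" "l' > 0"
    and mass: "k * measure lebesgue S + l * measure lebesgue T = k' * measure lebesgue S + l' * measure lebesgue T"
    and c: "\<And>x. x \<in> interior S \<Longrightarrow> c x = k" "\<And>x. x \<in> interior T \<Longrightarrow> c x = l"
    and c': "\<And>x. x \<in> interior S \<Longrightarrow> c' x = k'" "\<And>x. x \<in> interior T \<Longrightarrow> c' x = l'"
  obtains f where "PL_transport 1 (S \<union> T) c (S \<union> T) c' f"
    "\<And>x. x \<in> S \<union> T \<Longrightarrow> x \<notin> interior (S \<union> T) \<Longrightarrow> f x = x"
proof -
  let ?d = "det (matrix M)" and ?q = "1 + ones \<bullet> z"
  \<comment> \<open>The \<open>max\<close> joins both charts in one formula: \<open>A\<close> up to
    the common facet, the sheared chart beyond it.\<close>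
  define \<Theta> where "\<Theta> x = A (x + max 0 (ones \<bullet> x - 1) *\<^sub>R z)" for x
  define N where "N = M \<circ> (\<lambda>x. x + (ones \<bullet> x) *\<^sub>R z)"
  have linz: "linear (\<lambda>x. x + (ones \<bullet> x) *\<^sub>R z)"
    by (rule linearI) (simp_all add: algebra_simps inner_add_right)
  have N: "linear N" "det (matrix N) = ?d * ?q"
    unfolding N_def using M(1) linz
    by (simp_all add: linear_compose matrix_compose det_mul det_identity_plus_rank_one)
  have N_eq: "A (x + (ones \<bullet> x - 1) *\<^sub>R z) = N x + (a - M z)" for x
    unfolding A_def N_def
    by (simp add: linear_add[OF M(1)] linear_scale[OF M(1)] linear_diff[OF M(1)] algebra_simps)
  have q: "?q > 0" using z by simp
  have std0: "measure lebesgue (std_cell :: (real^'n) set) > 0"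
  proof -
    have "interior (std_cell :: (real^'n) set) \<noteq> {}"
    proof -
      have "(Basis :: (real^'n) set) = range (\<lambda>i. axis i 1)" by (auto simp: Basis_vec_def)
      then show ?thesis
        using interior_std_simplex_nonempty[where 'a="real^'n"] unfolding std_cell_hull by (metis empty_iff)
    qed
    moreover have "convex (std_cell :: (real^'n) set)"
      by (rule polytope_imp_convex[OF polytope_std_cell])
    ultimately have "\<not> negligible (std_cell :: (real^'n) set)"
      by (simp add: negligible_convex_interior)
    then show ?thesis
      using measure_nonneg[of lebesgue "std_cell :: (real^'n) set"]
      by (simp add: negligible_iff_measure lmeasurable_polytope[OF polytope_std_cell] order_le_less)
  qed
  have mS: "measure lebesgue S = \<bar>?d\<bar> * measure lebesgue (std_cell :: (real^'n) set)"
    unfolding S_def A_def by (rule measure_affine_image[OF M(1) polytope_std_cell])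
  have mT: "measure lebesgue T = \<bar>?d\<bar> * ?q * measure lebesgue (std_cell :: (real^'n) set)"
    unfolding T_def N_eq using measure_affine_image[OF N(1) polytope_mirror_cell] q
    by (simp add: N(2) abs_mult measure_mirror_cell)
  have mass': "\<bar>?d\<bar> * k + \<bar>?d\<bar> * ?q * l = \<bar>?d\<bar> * k' + \<bar>?d\<bar> * ?q * l'"
  proof -
    have "(\<bar>?d\<bar> * k + \<bar>?d\<bar> * ?q * l) * measure lebesgue (std_cell :: (real^'n) set)
       = (\<bar>?d\<bar> * k' + \<bar>?d\<bar> * ?q * l') * measure lebesgue (std_cell :: (real^'n) set)"
      using mass unfolding mS mT by (simp add: algebra_simps)
    then show ?thesis using std0 by simp
  qed
  have inj: "inj \<Theta>"
  proof (rule injI)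
    fix x y assume "\<Theta> x = \<Theta> y"
    then have eq: "x + max 0 (ones \<bullet> x - 1) *\<^sub>R z = y + max 0 (ones \<bullet> y - 1) *\<^sub>R z"
      using M det_nz_iff_inj unfolding \<Theta>_def A_def by (auto dest: injD)
    then have "ones \<bullet> (x + max 0 (ones \<bullet> x - 1) *\<^sub>R z) = ones \<bullet> (y + max 0 (ones \<bullet> y - 1) *\<^sub>R z)"
      by simp
    then have s: "ones \<bullet> x + max 0 (ones \<bullet> x - 1) * (ones \<bullet> z) = ones \<bullet> y + max 0 (ones \<bullet> y - 1) * (ones \<bullet> z)"
      by (simp add: inner_add_right)
    \<comment> \<open>The level \<open>ones \<bullet> x\<close> undergoes a strictly increasing
      change, with slope 1 below the facet and \<open>?q\<close> beyond it. So the level is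
      recovered first, and then the shear is undone.\<close>
    have mono: "u + max 0 (u - 1) * (ones \<bullet> z) < v + max 0 (v - 1) * (ones \<bullet> z)" if "u < v" for u v :: real
    proof -
      have "(v - u) * (-1) < (v - u) * (ones \<bullet> z)" using that z by (intro mult_strict_left_mono) auto
      moreover have "v \<ge> 1 \<Longrightarrow> (v - 1) * (-1) \<le> (v - 1) * (ones \<bullet> z)" using z by (intro mult_left_mono) auto
      ultimately show ?thesis using that by (auto simp: max_def algebra_simps)
    qed
    then have "ones \<bullet> x = ones \<bullet> y" using s mono[of "ones \<bullet> x" "ones \<bullet> y"] mono[of "ones \<bullet> y" "ones \<bullet> x"] by linarith
    then show "x = y" using eq by simp
  qed
  have \<Theta>S: "\<Theta> x = M x + a" if "x \<in> std_cell" for x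
    using that by (auto simp: \<Theta>_def A_def std_cell_def)
  have \<Theta>T: "\<Theta> x = N x + (a - M z)" if "x \<in> mirror_cell" for x
    using that N_eq by (auto simp: \<Theta>_def mirror_cell_def)
  have img: "\<Theta> ` std_cell = S" "\<Theta> ` mirror_cell = T"
    unfolding S_def T_def A_def[symmetric] using \<Theta>S \<Theta>T N_eq by (auto simp: A_def image_iff)
  have imgU: "\<Theta> ` bipyramid = S \<union> T"
    unfolding bipyramid_eq using img by auto
  \<comment> \<open>Stated for arbitrary \<open>e\<close>, \<open>u\<close> and \<open>v\<close>,
    because the chart has to carry both the given and the desired density back to the
    bipyramid.\<close>
  have transp: "PL_transport ?d bipyramid (\<lambda>x. if ones \<bullet> x < 1 then \<bar>?d\<bar> * u else \<bar>?d\<bar> * ?q * v) (S \<union> T) e \<Theta>"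
    if e: "\<And>x. x \<in> interior S \<Longrightarrow> e x = u" "\<And>x. x \<in> interior T \<Longrightarrow> e x = v" for e u v
    unfolding PL_transport_def
  proof (intro conjI exI[of _ "{std_cell, mirror_cell}"] ballI)
    show "inj_on \<Theta> bipyramid" using inj by (rule inj_on_subset) simp
    fix X :: "(real^'n) set" assume X: "X \<in> {std_cell, mirror_cell}"
    show "polytope X" using X polytope_std_cell polytope_mirror_cell by auto
    from X show "\<exists>L b. linear L \<and> ?d * det (matrix L) > 0 \<and> (\<forall>x\<in>X. \<Theta> x = L x + b) \<and>
       (\<forall>x\<in>interior X. \<bar>det (matrix L)\<bar> * e (\<Theta> x) = (if ones \<bullet> x < 1 then \<bar>?d\<bar> * u else \<bar>?d\<bar> * ?q * v))"
    proof (elim insertE emptyE)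
      assume X: "X = std_cell"
      have "\<bar>?d\<bar> * e (\<Theta> x) = (if ones \<bullet> x < 1 then \<bar>?d\<bar> * u else \<bar>?d\<bar> * ?q * v)" if "x \<in> interior X" for x
      proof -
        have "ones \<bullet> x < 1"
          by (rule interior_le_hyperplane[OF ones_nonzero that]) (auto simp: X std_cell_def)
        moreover have "\<Theta> x \<in> interior S"
          using that interior_subset \<Theta>S interior_affine_image[OF M, of a std_cell] unfolding X S_def A_def by auto
        ultimately show ?thesis using e by simp
      qed
      then show ?thesis using M \<Theta>S X by (intro exI[of _ M] exI[of _ a]) (auto simp: zero_less_mult_iff)
    next
      assume X: "X = mirror_cell"
      have nz: "det (matrix N) \<noteq> 0" using N(2) M(2) q by auto
      have "\<bar>det (matrix N)\<bar> * e (\<Theta> x) = (if ones \<bullet> x < 1 then \<bar>?d\<bar> * u else \<bar>?d\<bar> * ?q * v)" if "x \<in> interior X" for x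
      proof -
        have "ones \<bullet> x > 1"
          by (rule interior_ge_hyperplane[OF ones_nonzero that]) (auto simp: X mirror_cell_def)
        moreover have "\<Theta> x \<in> interior T"
          using that interior_subset \<Theta>T interior_affine_image[OF N(1) nz, of "a - M z" mirror_cell] unfolding X T_def N_eq by auto
        ultimately show ?thesis using e q N(2) by (simp add: abs_mult)
      qed
      moreover have "?d * ?d > 0" using M(2) by (auto simp: zero_less_mult_iff)
      then have "?d * det (matrix N) > 0" unfolding N(2) mult.assoc[symmetric] using q by (rule mult_pos_pos)
      ultimately show ?thesis using N(1) \<Theta>T X by (intro exI[of _ N] exI[of _ "a - M z"]) auto
    qed
  qed (use imgU bipyramid_eq in auto)
  let ?c0 = "\<lambda>x::real^'n. if ones \<bullet> x < 1 then \<bar>?d\<bar> * k else \<bar>?d\<bar> * ?q * l"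
  let ?c0' = "\<lambda>x::real^'n. if ones \<bullet> x < 1 then \<bar>?d\<bar> * k' else \<bar>?d\<bar> * ?q * l'"
  obtain g :: "real^'n \<Rightarrow> real^'n" where g: "PL_transport 1 bipyramid ?c0 bipyramid ?c0' g"
    "\<And>x. x \<in> bipyramid \<Longrightarrow> tent x = 0 \<Longrightarrow> g x = x"
    by (rule PL_transport_bipyramid[OF _ _ _ _ mass', of ?c0 ?c0']) (use pos M(2) q in auto)
  let ?f = "\<Theta> \<circ> (g \<circ> the_inv_into bipyramid \<Theta>)"
  \<comment> \<open>Entering and leaving the chart contributes the sign of \<open>?d\<close> twice,
    so orientation is preserved even if the chart reverses it.\<close>
  have "PL_transport (?d * 1 * ?d) (S \<union> T) c (S \<union> T) c' ?f"
    using PL_transport_comp[OF PL_transport_comp[OF PL_transport_inverse[OF transp[OF c]] g(1)] transp[OF c']] by simp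
  then have 1: "PL_transport 1 (S \<union> T) c (S \<union> T) c' ?f"
    by (rule PL_transport_cong_sign) (use M(2) in \<open>auto simp: zero_less_mult_iff\<close>)
  have cont: "continuous_on UNIV \<Theta>"
    unfolding \<Theta>_def A_def using linear_continuous_on_compose[OF _ M(1)]
    by (intro continuous_intros linear_continuous_on_compose[OF _ M(1)])
  have cont_tent: "continuous_on UNIV (tent :: real^'n \<Rightarrow> real)"
  proof -
    have eq: "min_coord x = Inf (range (($) x))" for x :: "real^'n"
      unfolding min_coord_def by (rule cInf_eq_Min[symmetric]) auto
    have "continuous_on UNIV (min_coord :: real^'n \<Rightarrow> real)"
    proof -
      have "\<bar>min_coord x - min_coord y\<bar> \<le> dist x y" for x y :: "real^'n"
      proof -
        obtain i j where "\<And>l. x$i \<le> x$l" "\<And>l. y$j \<le> y$l" using min_coord_attained by metis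
        then have "min_coord x = x$i" "min_coord y = y$j" "x$i \<le> x$j" "y$j \<le> y$i" using min_coord_eqI by auto
        moreover have "\<bar>x$l - y$l\<bar> \<le> dist x y" for l
          using component_le_norm_cart[of "x - y" l] by (simp add: dist_norm)
        ultimately show ?thesis by (smt (verit))
      qed
      then show ?thesis unfolding continuous_on_iff dist_real_def by (meson order_le_less_trans)
    qed
    moreover have "continuous_on UNIV (excess :: real^'n \<Rightarrow> real)"
      unfolding excess_def by (intro continuous_intros)
    ultimately show ?thesis unfolding tent_def by (intro continuous_intros)
  qed
  have "open {x::real^'n. 0 < tent x}"
    using cont_tent by (intro open_Collect_less continuous_intros)
  \<comment> \<open>Invariance of domain makes points with positive \<open>tent\<close> interior to
    \<open>S \<union> T\<close>. A boundary point of the union therefore comes from some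
    \<open>y\<close> with \<open>tent y = 0\<close>, where \<open>g\<close> is the identity.\<close>
  then have "open (\<Theta> ` {x. 0 < tent x})"
    using cont inj by (intro invariance_of_domain) (auto intro: continuous_on_subset inj_on_subset)
  then have sub: "\<Theta> ` {x. 0 < tent x} \<subseteq> interior (S \<union> T)"
    unfolding imgU[symmetric] by (intro interior_maximal image_mono) (auto simp: bipyramid_def)
  have 2: "?f x = x" if x: "x \<in> S \<union> T" "x \<notin> interior (S \<union> T)" for x
  proof -
    obtain y where y: "y \<in> bipyramid" "x = \<Theta> y" using x imgU by blast
    then have "tent y = 0" using sub x(2) unfolding bipyramid_def by fastforce
    moreover have "the_inv_into bipyramid \<Theta> x = y"
      using y inj by (simp add: the_inv_into_f_f inj_on_def)
    ultimately show ?thesis using g(2) y by simp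
  qed
  show thesis using that 1 2 by blast
qed

section \<open>Two simplices with a common facet in standard position\<close>

lemma interior_nonempty_iff_aff_dim:
  fixes S :: "'a::euclidean_space set"
  assumes "convex S"
  shows "interior S \<noteq> {} \<longleftrightarrow> aff_dim S = DIM('a)"
proof
  assume "interior S \<noteq> {}"
  then show "aff_dim S = DIM('a)"
    by (simp add: aff_dim_eq_full affine_hull_nonempty_interior)
next
  assume dim: "aff_dim S = DIM('a)"
  then have "affine hull S = UNIV" by (simp add: aff_dim_eq_full)
  then have "interior S = rel_interior S" by (simp add: rel_interior_interior)
  moreover have "S \<noteq> {}" using dim by auto
  ultimately show "interior S \<noteq> {}" using assms rel_interior_eq_empty by metis
qed

lemma interior_affine_hull_lowdim:
  fixes S :: "'a::euclidean_space set"
  assumes "aff_dim S < DIM('a)"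
  shows "interior (affine hull S) = {}"
  using assms interior_nonempty_iff_aff_dim[of "affine hull S"] by (auto simp: aff_dim_affine_hull affine_imp_convex)

lemma convex_hull_affine_image:
  assumes "linear L"
  shows "(\<lambda>x. L x + b) ` (convex hull Y) = convex hull ((\<lambda>x. L x + b) ` Y)"
proof -
  have eq: "(\<lambda>x. L x + b) ` Z = (+) b ` (L ` Z)" for Z
    by (auto simp: image_image add.commute)
  show ?thesis unfolding eq using assms by (simp add: convex_hull_linear_image convex_hull_translation)
qed

lemma axis_expansion:
  fixes x :: "real^'n"
  shows "(\<Sum>i\<in>UNIV. x$i *\<^sub>R axis i 1) = x"
  by (simp add: vec_eq_iff axis_def if_distrib cong: if_cong)

text \<open>An affine chart sends the vertex \<open>u\<close> of \<open>S\<close> off the facet to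
  the origin and the vertices of the facet to the standard basis. What remains is to show that the
  other apex lies strictly beyond the hyperplane of the facet.\<close>

lemma adjacent_simplices_standard_form:
  fixes S T :: "(real^'n) set"
  assumes S: "int CARD('n) simplex S" and T: "int CARD('n) simplex T"
    and face: "S \<inter> T face_of S" "S \<inter> T face_of T"
    and dim: "aff_dim (S \<inter> T) = int CARD('n) - 1"
  obtains M :: "real^'n \<Rightarrow> real^'n" and a z :: "real^'n"
  where "linear M" "det (matrix M) \<noteq> 0" "ones \<bullet> z > -1"
    "S = (\<lambda>x. M x + a) ` std_cell"
    "T = (\<lambda>x. M (x + (ones \<bullet> x - 1) *\<^sub>R z) + a) ` mirror_cell"
proof -
  let ?d = "real CARD('n)"
  obtain C where C: "\<not> affine_dependent C" "card C = Suc CARD('n)" "S = convex hull C" "finite C"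
    using S unfolding simplex by force
  obtain E where E: "\<not> affine_dependent E" "card E = Suc CARD('n)" "T = convex hull E" "finite E"
    using T unfolding simplex by force
  obtain V where V: "V \<subseteq> C" "S \<inter> T = convex hull V"
    using face(1) C(1,3) face_of_convex_hull_affine_independent by blast
  obtain W where W: "W \<subseteq> E" "S \<inter> T = convex hull W"
    using face(2) E(1,3) face_of_convex_hull_affine_independent by blast
  have indep: "\<not> affine_dependent V" "\<not> affine_dependent W"
    using C(1) E(1) V(1) W(1) affine_dependent_subset by blast+
  \<comment> \<open>The vertex sets found from the two sides agree, both being the extreme points of
    the common face.\<close>
  have "V = {x. x extreme_point_of (convex hull V)}"
    using indep(1) by (simp add: extreme_point_of_convex_hull_affine_independent)
  also have "\<dots> = {x. x extreme_point_of (convex hull W)}"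
    using V(2) W(2) by simp
  also have "\<dots> = W"
    using indep(2) by (simp add: extreme_point_of_convex_hull_affine_independent)
  finally have WV: "W = V" by simp
  have cardV: "card V = CARD('n)"
    using aff_dim_affine_independent[OF indep(1)] dim V(2) by (simp add: aff_dim_convex_hull)
  have finV: "finite V" using V(1) C(4) finite_subset by blast
  have "card (C - V) = 1" "card (E - V) = 1"
    using V(1) W(1) WV finV C(2) E(2) cardV by (simp_all add: card_Diff_subset)
  then obtain u w where "C - V = {u}" "E - V = {w}" by (meson card_1_singletonE)
  then have u: "C = insert u V" and w: "E = insert w V" using V(1) W(1) WV by auto
  obtain v where v: "bij_betw v (UNIV :: 'n set) V"
    using finite_same_card_bij[OF _ finV] cardV by (metis finite_class.finite_UNIV)
  then have vV: "range v = V" by (simp add: bij_betw_def)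
  define M where "M x = (\<Sum>i\<in>UNIV. x$i *\<^sub>R (v i - u))" for x :: "real^'n"
  have linM: "linear M"
    unfolding M_def by (rule linearI) (simp_all add: scaleR_left_distrib sum.distrib scaleR_sum_right)
  have M_axis: "M (axis i 1) = v i - u" for i
    unfolding M_def by (simp add: axis_def if_distrib[of "\<lambda>c. c *\<^sub>R _"] cong: if_cong)
  have hull_eq: "(\<lambda>x. M x + u) ` std_cell = S"
    unfolding std_cell_hull convex_hull_affine_image[OF linM] C(3) u vV[symmetric]
    by (simp add: image_image M_axis linear_0[OF linM])
  have int_ne: "interior S \<noteq> {}" "interior T \<noteq> {}"
    using interior_nonempty_iff_aff_dim[OF convex_simplex[OF S]] aff_dim_simplex[OF S]
      interior_nonempty_iff_aff_dim[OF convex_simplex[OF T]] aff_dim_simplex[OF T] by simp_all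
  have detM: "det (matrix M) \<noteq> 0"
  proof
    assume "det (matrix M) = 0"
    then have "negligible (M ` std_cell)"
      using linM det_nz_iff_inj negligible_linear_singular_image by blast
    then have "negligible ((+) u ` (M ` std_cell))" by (rule negligible_translation)
    moreover have "(+) u ` (M ` std_cell) = S" unfolding hull_eq[symmetric] by (auto simp: image_image add.commute)
    ultimately have "negligible S" by simp
    then show False using int_ne(1) negligible_convex_interior convex_simplex[OF S] by blast
  qed
  obtain N where N: "linear N" "\<And>x. N (M x) = x" "\<And>x. M (N x) = x"
    using linear_det_nz_inverse[OF linM detM] by metis
  define w0 where "w0 = N (w - u)"
  have w0: "M w0 + u = w" by (simp add: w0_def N)
  define p :: "real^'n" where "p = (1 / ?d) *\<^sub>R ones"
  have p1: "ones \<bullet> p = 1" by (simp add: p_def inner_ones_ones)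
  have A_hyper: "ones \<bullet> x = 1" if x: "M x + u \<in> convex hull V" for x
  proof -
    have "convex hull V = (\<lambda>x. M x + u) ` (convex hull (range (\<lambda>i. axis i 1)))"
      unfolding convex_hull_affine_image[OF linM] vV[symmetric] by (simp add: image_image M_axis)
    then obtain y where y: "y \<in> convex hull (range (\<lambda>i. axis i 1))" "M x + u = M y + u" using x by auto
    then have "x = y" using N(2) by (metis add_right_cancel)
    moreover have "convex hull (range (\<lambda>i. axis i 1)) \<subseteq> {y :: real^'n. ones \<bullet> y = 1}"
      by (rule hull_minimal) (auto simp: axis_le_ones convex_hyperplane)
    ultimately show ?thesis using y by auto
  qed
  have pV: "M p + u \<in> T"
  proof -
    have "p \<in> convex hull (range (\<lambda>i. axis i 1))"
    proof -
      have "(\<Sum>i\<in>UNIV. (1 / ?d) *\<^sub>R axis i (1::real)) \<in> convex hull (range (\<lambda>i. axis i (1::real) :: real^'n))"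
        by (rule convex_sum) (auto intro: hull_inc)
      moreover have "(\<Sum>i\<in>UNIV. (1 / ?d) *\<^sub>R axis i (1::real)) = p"
        using axis_expansion[of p] by (simp add: p_def)
      ultimately show ?thesis by simp
    qed
    then have "M p + u \<in> (\<lambda>x. M x + u) ` (convex hull (range (\<lambda>i. axis i 1)))" by blast
    also have "\<dots> = convex hull V"
      unfolding convex_hull_affine_image[OF linM] vV[symmetric] by (simp add: image_image M_axis)
    finally show ?thesis using V(2) by blast
  qed
  have wT: "w \<in> T" unfolding E(3) w by (simp add: hull_inc)
  \<comment> \<open>Otherwise a small step from the barycentre \<open>p\<close> of the facet towards
    \<open>w0\<close> stays in \<open>S\<close> and in \<open>T\<close>, whose intersection lies in
    the hyperplane. This forces \<open>w0\<close> into the hyperplane and makes \<open>T\<close>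
    flat.\<close>
  have gt: "ones \<bullet> w0 > 1"
  proof (rule ccontr)
    assume "\<not> ones \<bullet> w0 > 1"
    then have le: "ones \<bullet> w0 \<le> 1" by simp
    have dpos: "?d > 0" by simp
    \<comment> \<open>Small enough that no coordinate changes by more than \<open>1 / ?d\<close>,
      the value of every coordinate of \<open>p\<close>, and at most 1, so that the point stays on
      the segment to \<open>w0\<close>.\<close>
    define \<epsilon> where "\<epsilon> = 1 / (1 + ?d * norm (w0 - p))"
    have den: "1 + ?d * norm (w0 - p) > 0"
      using dpos by (smt (verit) mult_nonneg_nonneg norm_ge_zero)
    have eps: "0 < \<epsilon>" "\<epsilon> \<le> 1" using den by (auto simp: \<epsilon>_def)
    have small: "\<epsilon> * norm (w0 - p) \<le> 1 / ?d"
      using den dpos by (simp add: \<epsilon>_def field_simps)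
    define y where "y = p + \<epsilon> *\<^sub>R (w0 - p)"
    have "0 \<le> y$i" for i
    proof -
      have "\<bar>\<epsilon> * (w0 - p)$i\<bar> \<le> \<epsilon> * norm (w0 - p)"
        using component_le_norm_cart[of "w0 - p" i] eps by (simp add: abs_mult)
      moreover have "p$i = 1 / ?d" by (simp add: p_def)
      ultimately show ?thesis using small by (simp add: y_def)
    qed
    moreover have onesy: "ones \<bullet> y = 1 + \<epsilon> * (ones \<bullet> w0 - 1)"
      by (simp add: y_def inner_add_right inner_diff_right p1)
    then have "ones \<bullet> y \<le> 1" using eps le by (simp add: mult_nonneg_nonpos)
    ultimately have "y \<in> std_cell" by (simp add: std_cell_def)
    then have "M y + u \<in> S" using hull_eq by blast
    moreover have "M y + u \<in> T"
    proof -
      have "M y + u = (1 - \<epsilon>) *\<^sub>R (M p + u) + \<epsilon> *\<^sub>R w"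
        unfolding w0[symmetric] y_def
        by (simp add: linear_add[OF linM] linear_diff[OF linM] linear_scale[OF linM] algebra_simps)
      then show ?thesis
        using convexD[OF convex_simplex[OF T] pV wT, of "1 - \<epsilon>" \<epsilon>] eps by simp
    qed
    ultimately have "ones \<bullet> y = 1" using A_hyper V(2) by blast
    then have w1: "ones \<bullet> w0 = 1" using onesy eps by simp
    have "E \<subseteq> (\<lambda>x. M x + u) ` {x. ones \<bullet> x = 1}"
    proof
      fix e assume "e \<in> E"
      then consider "e = w" | "e \<in> V" using w by blast
      then show "e \<in> (\<lambda>x. M x + u) ` {x. ones \<bullet> x = 1}"
      proof cases
        case 1 then show ?thesis using w0 w1 by blast
      next
        case 2
        then obtain i where "e = v i" using vV by blast
        then have "e = M (axis i 1) + u" using M_axis by simp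
        then show ?thesis using axis_le_ones by blast
      qed
    qed
    moreover have "convex ((\<lambda>x. M x + u) ` {x. ones \<bullet> x = 1})"
    proof -
      have "(\<lambda>x. M x + u) ` {x. ones \<bullet> x = 1} = (+) u ` (M ` {x. ones \<bullet> x = 1})"
        by (auto simp: image_image add.commute)
      then show ?thesis
        using linM by (simp add: convex_translation convex_linear_image convex_hyperplane)
    qed
    ultimately have "T \<subseteq> (\<lambda>x. M x + u) ` {x. ones \<bullet> x = 1}"
      unfolding E(3) by (rule hull_minimal)
    then have "interior T \<subseteq> interior ((\<lambda>x. M x + u) ` {x. ones \<bullet> x = 1})" by (rule interior_mono)
    then show False
      using int_ne(2) unfolding interior_affine_image[OF linM detM] by (simp add: ones_nonzero)
  qed
  \<comment> \<open>The apex of \<open>mirror_cell\<close> is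
    \<open>(2 / ?d) *\<^sub>R ones\<close>, at which \<open>ones \<bullet> x - 1 = 1\<close>; adding
    \<open>z\<close> there must give \<open>w0\<close>.\<close>
  define z where "z = w0 - (2 / ?d) *\<^sub>R ones"
  have z: "ones \<bullet> z > -1" using gt by (simp add: z_def inner_diff_right inner_ones_ones)
  have "(\<lambda>x. M (x + (ones \<bullet> x - 1) *\<^sub>R z) + u) ` mirror_cell = T"
  proof -
    obtain R :: "real^'n \<Rightarrow> real^'n" and b where R: "linear R" "mirror = (\<lambda>x. R x + b)"
      by (rule mirror_affine)
    let ?K = "\<lambda>x. x + (ones \<bullet> x) *\<^sub>R z"
    have linK: "linear ?K"
      by (rule linearI) (simp_all add: algebra_simps inner_add_right)
    let ?B = "\<lambda>x. M (x + (ones \<bullet> x - 1) *\<^sub>R z) + u"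
    have B: "?B x = (M \<circ> ?K) x + (u - M z)" for x
      by (simp add: linear_add[OF linM] linear_diff[OF linM] linear_scale[OF linM] algebra_simps)
    have BR: "?B (mirror x) = (M \<circ> ?K \<circ> R) x + ((M \<circ> ?K) b + (u - M z))" for x
      using B[of "mirror x"] linear_add[OF linear_compose[OF linK linM], of "R x" b] by (simp add: R(2))
    have lin: "linear (M \<circ> ?K \<circ> R)"
      using linear_compose linM linK R(1) by blast
    have "?B ` mirror_cell = (\<lambda>x. ?B (mirror x)) ` std_cell"
      by (simp add: image_image flip: mirror_image_std_cell)
    also have "\<dots> = convex hull ((\<lambda>x. ?B (mirror x)) ` (insert 0 (range (\<lambda>i. axis i 1))))"
      unfolding BR std_cell_hull by (rule convex_hull_affine_image[OF lin])
    also have "(\<lambda>x. ?B (mirror x)) ` (insert 0 (range (\<lambda>i. axis i 1))) = insert w (range v)"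
    proof -
      have "mirror (axis i 1) = axis i (1::real)" for i :: 'n
        by (simp add: mirror_def excess_def axis_le_ones)
      then have "?B (mirror (axis i 1)) = v i" for i
        by (simp add: axis_le_ones M_axis)
      moreover have "mirror 0 = (2 / ?d) *\<^sub>R (ones :: real^'n)"
        by (simp add: mirror_def excess_def)
      then have "?B (mirror 0) = w"
        using w0 by (simp add: z_def inner_ones_ones)
      ultimately show ?thesis by (simp add: image_image)
    qed
    also have "convex hull (insert w (range v)) = T"
      unfolding E(3) w vV ..
    finally show ?thesis .
  qed
  then show thesis using that[of M z u] linM detM z hull_eq by blast
qed

section \<open>Moving mass in a simplicial partition\<close>

text \<open>Gluing with the identity. A cell of \<open>E\<close> can touch \<open>U\<close> only
  outside \<open>interior U\<close>, where \<open>f\<close> fixes every point, so the glued map is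
  the identity on all of that cell.\<close>

lemma PL_transport_extend:
  fixes U :: "(real^'n) set"
  assumes f: "PL_transport 1 U c U c' f"
    and fixed: "\<And>x. x \<in> U \<Longrightarrow> x \<notin> interior U \<Longrightarrow> f x = x"
    and E: "finite E" "\<And>X. X \<in> E \<Longrightarrow> polytope X" "\<And>X. X \<in> E \<Longrightarrow> X \<inter> interior U = {}"
      "\<And>X x. X \<in> E \<Longrightarrow> x \<in> interior X \<Longrightarrow> c x = c' x"
  shows "PL_transport 1 (U \<union> \<Union>E) c (U \<union> \<Union>E) c' (\<lambda>x. if x \<in> U then f x else x)"
    (is "PL_transport 1 _ c _ c' ?g")
proof -
  have inj: "inj_on f U" and img: "f ` U = U"
    using f PL_transport_inj_on PL_transport_image by blast+
  obtain D where D: "finite D" "\<And>X. X\<in>D \<Longrightarrow> polytope X" "\<Union>D = U"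
    "\<And>X. X\<in>D \<Longrightarrow> \<exists>L b. linear L \<and> 1 * det (matrix L) > 0 \<and> (\<forall>x\<in>X. f x = L x + b) \<and>
         (\<forall>x\<in>interior X. \<bar>det (matrix L)\<bar> * c' (f x) = c x)"
    using f unfolding PL_transport_def by metis
  have fU: "f x \<in> U" if "x \<in> U" for x using img that by blast
  have mat: "matrix (\<lambda>x. x) = (mat 1 :: real^'n^'n)"
    using matrix_id_mat_1 by (simp add: id_def)
  have gE: "?g x = x" if "X \<in> E" "x \<in> X" for x X
    using that E(3)[of X] fixed by auto
  have pieceE: "\<exists>L b. linear L \<and> 1 * det (matrix L) > 0 \<and> (\<forall>x\<in>X. ?g x = L x + b) \<and>
         (\<forall>x\<in>interior X. \<bar>det (matrix L)\<bar> * c' (?g x) = c x)" if "X \<in> E" for X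
  proof -
    have "\<forall>x\<in>X. ?g x = x + 0" using gE[OF that] by simp
    moreover have "\<forall>x\<in>interior X. \<bar>det (matrix (\<lambda>x::real^'n. x))\<bar> * c' (?g x) = c x"
      using gE[OF that] E(4)[OF that] interior_subset[of X] unfolding mat by (simp add: subset_iff)
    ultimately show ?thesis
      by (intro exI[of _ "\<lambda>x. x"] exI[of _ 0]) (simp add: mat linear_ident)
  qed
  have pieceD: "\<exists>L b. linear L \<and> 1 * det (matrix L) > 0 \<and> (\<forall>x\<in>X. ?g x = L x + b) \<and>
         (\<forall>x\<in>interior X. \<bar>det (matrix L)\<bar> * c' (?g x) = c x)" if X: "X \<in> D" for X
  proof -
    have g: "?g x = f x" if "x \<in> X" for x using that X D(3) by auto
    obtain L b where L: "linear L" "1 * det (matrix L) > 0" "\<And>x. x \<in> X \<Longrightarrow> f x = L x + b"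
         "\<And>x. x\<in>interior X \<Longrightarrow> \<bar>det (matrix L)\<bar> * c' (f x) = c x"
      using D(4)[OF X] by blast
    have "\<forall>x\<in>X. ?g x = L x + b" using g L(3) by simp
    moreover have "\<forall>x\<in>interior X. \<bar>det (matrix L)\<bar> * c' (?g x) = c x"
      using g L(4) interior_subset[of X] by (simp add: subset_iff)
    ultimately show ?thesis using L(1,2) by blast
  qed
  show ?thesis
    unfolding PL_transport_def
  proof (intro conjI exI[of _ "D \<union> E"])
    show "inj_on ?g (U \<union> \<Union>E)"
    proof (rule inj_onI)
      fix x y assume "?g x = ?g y"
      then show "x = y" using fU[of x] fU[of y] inj_onD[OF inj, of x y] by (auto split: if_splits)
    qed
    show "?g ` (U \<union> \<Union>E) = U \<union> \<Union>E"
    proof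
      show "?g ` (U \<union> \<Union>E) \<subseteq> U \<union> \<Union>E" using fU by auto
      show "U \<union> \<Union>E \<subseteq> ?g ` (U \<union> \<Union>E)"
      proof
        fix y assume y: "y \<in> U \<union> \<Union>E"
        show "y \<in> ?g ` (U \<union> \<Union>E)"
        proof (cases "y \<in> U")
          case True
          then obtain x where "x \<in> U" "y = f x" using img by blast
          then show ?thesis by (intro image_eqI[of _ _ x]) auto
        next
          case False
          then show ?thesis using y by (intro image_eqI[of _ _ y]) auto
        qed
      qed
    qed
    show "finite (D \<union> E)" using D(1) E(1) by simp
    show "\<forall>X\<in>D \<union> E. polytope X" using D(2) E(2) by blast
    show "\<Union>(D \<union> E) = U \<union> \<Union>E" using D(3) by auto
    show "\<forall>X\<in>D \<union> E. \<exists>L b. linear L \<and> 1 * det (matrix L) > 0 \<and> (\<forall>x\<in>X. ?g x = L x + b) \<and>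
         (\<forall>x\<in>interior X. \<bar>det (matrix L)\<bar> * c' (?g x) = c x)"
      by (intro ball_Un[THEN iffD2] conjI ballI) (rule pieceD, assumption, rule pieceE, assumption)
  qed
qed

section \<open>Cells, masses and the dual graph\<close>

locale simplicial_partition =
  fixes T :: "(real^'n) set set"
  assumes finite_T: "finite T"
    and simplex: "X \<in> T \<Longrightarrow> int CARD('n) simplex X"
    and face: "X \<in> T \<Longrightarrow> Y \<in> T \<Longrightarrow> X \<inter> Y face_of X"
begin

lemma convex_cell: "X \<in> T \<Longrightarrow> convex X"
  using simplex convex_simplex by blast

lemma polytope_cell: "X \<in> T \<Longrightarrow> polytope X"
  using simplex simplex_imp_polytope by blast

lemma interior_cell_nonempty: "X \<in> T \<Longrightarrow> interior X \<noteq> {}"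
  using interior_nonempty_iff_aff_dim[OF convex_cell] aff_dim_simplex[OF simplex] by simp

lemma closure_interior_cell: "X \<in> T \<Longrightarrow> closure (interior X) = X"
  using convex_closure_interior[OF convex_cell interior_cell_nonempty] polytope_imp_closed[OF polytope_cell]
  by (simp add: closure_closed)

lemma measure_cell_pos: "X \<in> T \<Longrightarrow> measure lebesgue X > 0"
  using negligible_convex_interior[OF convex_cell] interior_cell_nonempty lmeasurable_polytope[OF polytope_cell]
    measure_nonneg[of lebesgue X]
  by (auto simp: negligible_iff_measure order_le_less)

text \<open>A face of \<open>X\<close> that meets \<open>interior X\<close> is all of
  \<open>X\<close>. For \<open>X \<inter> Y\<close> this gives \<open>X \<subseteq> Y\<close>, so
  \<open>interior X\<close> lies in \<open>interior Y\<close>, and the same argument gives the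
  reverse inclusion.\<close>

lemma Int_interior_cell:
  assumes "X \<in> T" "Y \<in> T" "X \<noteq> Y"
  shows "Y \<inter> interior X = {}"
proof (rule ccontr)
  assume ne: "Y \<inter> interior X \<noteq> {}"
  have sub: "A \<subseteq> B" if AB: "A \<in> T" "B \<in> T" "B \<inter> interior A \<noteq> {}" for A B
  proof -
    have "(A \<inter> B) \<inter> interior A \<noteq> {}" using AB(3) interior_subset by blast
    then have "A \<inter> B = A" using face_of_disjoint_interior[OF face[OF AB(1,2)]] by blast
    then show ?thesis by blast
  qed
  have "X \<subseteq> Y" using sub[OF assms(1,2) ne] .
  then have "X \<inter> interior Y \<noteq> {}"
    using interior_cell_nonempty[OF assms(1)] interior_mono[of X Y] interior_subset[of X] by blast
  then have "Y \<subseteq> X" using sub[OF assms(2,1)] by blast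
  with \<open>X \<subseteq> Y\<close> assms(3) show False by blast
qed

text \<open>As the closure of its interior, \<open>X\<close> would meet the open set in an interior
  point of its own; but that point lies in \<open>S\<close> or \<open>R\<close>, which avoid
  \<open>interior X\<close>. This is what lets a move on \<open>S \<union> R\<close> extend by the
  identity.\<close>

lemma cell_Int_interior_Un:
  assumes "S \<in> T" "R \<in> T" "X \<in> T" "X \<noteq> S" "X \<noteq> R"
  shows "X \<inter> interior (S \<union> R) = {}"
proof (rule ccontr)
  assume "X \<inter> interior (S \<union> R) \<noteq> {}"
  then have "closure (interior X) \<inter> interior (S \<union> R) \<noteq> {}"
    by (simp add: closure_interior_cell assms(3))
  then have "interior X \<inter> interior (S \<union> R) \<noteq> {}"
    using open_Int_closure_eq_empty[of "interior (S \<union> R)" "interior X"] by (auto simp: Int_commute)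
  then have "interior X \<inter> (S \<union> R) \<noteq> {}" using interior_subset by blast
  then show False
    using Int_interior_cell[OF assms(3) assms(1)] Int_interior_cell[OF assms(3) assms(2)] assms(4,5) by blast
qed

definition has_masses :: "((real^'n) set \<Rightarrow> real) \<Rightarrow> (real^'n \<Rightarrow> real) \<Rightarrow> bool" where
  "has_masses m c \<longleftrightarrow> (\<forall>X\<in>T. \<forall>x\<in>interior X. c x = m X / measure lebesgue X)"

lemma has_massesD: "has_masses m c \<Longrightarrow> X \<in> T \<Longrightarrow> x \<in> interior X \<Longrightarrow> c x = m X / measure lebesgue X"
  unfolding has_masses_def by blast

text \<open>Masses leave a density undetermined on the cell boundaries. Demanding a map for every
  choice makes the relation independent of these values; \<open>ex_has_masses\<close> supplies the
  intermediate density for transitivity.\<close>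

definition transportable :: "((real^'n) set \<Rightarrow> real) \<Rightarrow> ((real^'n) set \<Rightarrow> real) \<Rightarrow> bool" where
  "transportable m m' \<longleftrightarrow> (\<forall>c c'. has_masses m c \<longrightarrow> has_masses m' c' \<longrightarrow>
     (\<exists>f. PL_transport 1 (\<Union>T) c (\<Union>T) c' f))"

definition adjacent :: "(real^'n) set \<Rightarrow> (real^'n) set \<Rightarrow> bool" where
  "adjacent X Y \<longleftrightarrow> X \<in> T \<and> Y \<in> T \<and> X \<noteq> Y \<and> aff_dim (X \<inter> Y) = int CARD('n) - 1"

lemma ex_has_masses: "\<exists>c. has_masses m c"
proof -
  let ?c = "\<lambda>x. m (THE X. X \<in> T \<and> x \<in> interior X) / measure lebesgue (THE X. X \<in> T \<and> x \<in> interior X)"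
  have "(THE X. X \<in> T \<and> x \<in> interior X) = X" if "X \<in> T" "x \<in> interior X" for X x
    using that Int_interior_cell interior_subset by (intro the_equality) blast+
  then have "has_masses m ?c" unfolding has_masses_def by simp
  then show ?thesis by blast
qed

lemma transportable_trans:
  assumes "transportable m m'" "transportable m' m''"
  shows "transportable m m''"
  unfolding transportable_def
proof (intro allI impI)
  fix c c'' assume c: "has_masses m c" "has_masses m'' c''"
  obtain c' where c': "has_masses m' c'" using ex_has_masses by blast
  obtain f g where "PL_transport 1 (\<Union>T) c (\<Union>T) c' f" "PL_transport 1 (\<Union>T) c' (\<Union>T) c'' g"
    using assms c c' unfolding transportable_def by blast
  from PL_transport_comp[OF this] show "\<exists>f. PL_transport 1 (\<Union>T) c (\<Union>T) c'' f" by auto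
qed

lemma transportable_eq:
  assumes "\<And>X. X \<in> T \<Longrightarrow> m X = m' X"
  shows "transportable m m'"
  unfolding transportable_def
proof (intro allI impI)
  fix c c' assume c: "has_masses m c" "has_masses m' c'"
  \<comment> \<open>Densities with equal masses may still differ on boundaries, so the identity is
    treated cell by cell, as an extension from the empty set.\<close>
  have "PL_transport 1 ({} \<union> \<Union>T) c ({} \<union> \<Union>T) c' (\<lambda>x. if x \<in> {} then x else x)"
  proof (intro PL_transport_extend)
    show "PL_transport 1 {} c {} c' (\<lambda>x. x)"
      unfolding PL_transport_def by (auto intro!: exI[of _ "{}"])
    show "c x = c' x" if "X \<in> T" "x \<in> interior X" for X x
      using has_massesD[OF c(1), of X x] has_massesD[OF c(2), of X x] that assms[of X] by simp
  qed (auto simp: finite_T polytope_cell)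
  then show "\<exists>f. PL_transport 1 (\<Union>T) c (\<Union>T) c' f" by auto
qed

lemma transportable_adjacent:
  assumes adj: "adjacent S R"
    and pos: "m S > 0" "m R > 0" "m' S > 0" "m' R > 0"
    and sum: "m S + m R = m' S + m' R"
    and eq: "\<And>X. X \<in> T \<Longrightarrow> X \<noteq> S \<Longrightarrow> X \<noteq> R \<Longrightarrow> m X = m' X"
  shows "transportable m m'"
  unfolding transportable_def
proof (intro allI impI)
  fix c c' assume c: "has_masses m c" "has_masses m' c'"
  have SR: "S \<in> T" "R \<in> T" "S \<noteq> R" using adj by (auto simp: adjacent_def)
  have vol: "measure lebesgue S > 0" "measure lebesgue R > 0" using SR measure_cell_pos by auto
  have fR: "S \<inter> R face_of R" using face[OF SR(2,1)] by (simp add: Int_commute)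
  have dim: "aff_dim (S \<inter> R) = int CARD('n) - 1" using adj by (simp add: adjacent_def)
  obtain M a z where *: "linear M" "det (matrix M) \<noteq> 0" "ones \<bullet> z > -1"
    "S = (\<lambda>x. M x + a) ` std_cell"
    "R = (\<lambda>x. M (x + (ones \<bullet> x - 1) *\<^sub>R z) + a) ` mirror_cell"
    by (rule adjacent_simplices_standard_form[OF simplex[OF SR(1)] simplex[OF SR(2)] face[OF SR(1,2)] fR dim])
  let ?k = "\<lambda>m X. m X / measure lebesgue X"
  obtain f where f: "PL_transport 1 (S \<union> R) c (S \<union> R) c' f"
    "\<And>x. x \<in> S \<union> R \<Longrightarrow> x \<notin> interior (S \<union> R) \<Longrightarrow> f x = x"
  proof (rule PL_transport_adjacent[OF *(1-3), where k="?k m S" and l="?k m R" and k'="?k m' S" and l'="?k m' R" and a=a and c=c and c'=c', folded *(4,5)])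
    show "?k m S * measure lebesgue S + ?k m R * measure lebesgue R = ?k m' S * measure lebesgue S + ?k m' R * measure lebesgue R"
      using vol sum by simp
  qed (use has_massesD[OF c(1)] has_massesD[OF c(2)] SR pos vol in simp_all)
  have "PL_transport 1 ((S \<union> R) \<union> \<Union>(T - {S,R})) c ((S \<union> R) \<union> \<Union>(T - {S,R})) c' (\<lambda>x. if x \<in> S \<union> R then f x else x)"
  proof (rule PL_transport_extend[OF f])
    show "X \<inter> interior (S \<union> R) = {}" if "X \<in> T - {S,R}" for X
      using cell_Int_interior_Un[OF SR(1,2)] that by blast
    show "c x = c' x" if "X \<in> T - {S,R}" "x \<in> interior X" for X x
      using has_massesD[OF c(1), of X x] has_massesD[OF c(2), of X x] that eq[of X] by simp
  qed (auto simp: finite_T polytope_cell)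
  moreover have "(S \<union> R) \<union> \<Union>(T - {S,R}) = \<Union>T" using SR by blast
  ultimately show "\<exists>f. PL_transport 1 (\<Union>T) c (\<Union>T) c' f" by auto
qed

text \<open>Each intermediate cell receives \<open>e\<close> before passing it on, so its mass never
  falls below the initial one; only \<open>S\<close> ends with less, and
  \<open>e < m S\<close>.\<close>

lemma transportable_path:
  assumes "adjacent\<^sup>*\<^sup>* S Y" "S \<in> T" "S \<noteq> Y" "\<And>X. X \<in> T \<Longrightarrow> m X > 0" "0 \<le> e" "e < m S"
  shows "transportable m (m(S := m S - e, Y := m Y + e))"
  using assms
proof (induction arbitrary: m rule: rtranclp_induct)
  case (step Y Z)
  have Z: "Z \<in> T" "Y \<in> T" "Y \<noteq> Z" using step.hyps(2) by (auto simp: adjacent_def)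
  show ?case
  proof (cases "S = Y")
    \<comment> \<open>The walk so far ends where it began; its last edge alone does the job.\<close>
    case True
    show ?thesis
      by (rule transportable_adjacent[OF step.hyps(2)]) (use True Z step.prems in \<open>auto intro: add_pos_nonneg\<close>)
  next
    case False
    let ?m1 = "m(S := m S - e, Y := m Y + e)"
    have "transportable m ?m1" using step.IH[OF step.prems(1) False, of m] step.prems(3-5) by blast
    moreover have "transportable ?m1 (m(S := m S - e, Z := m Z + e))"
      by (rule transportable_adjacent[OF step.hyps(2)])
        (use False Z step.prems in \<open>auto intro: add_pos_nonneg\<close>)
    ultimately show ?thesis by (rule transportable_trans)
  qed
qed auto

lemma transportable_same_total:
  assumes conn: "\<And>X Y. X \<in> T \<Longrightarrow> Y \<in> T \<Longrightarrow> adjacent\<^sup>*\<^sup>* X Y"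
    and pos': "\<And>X. X \<in> T \<Longrightarrow> m' X > 0"
    and pos: "\<And>X. X \<in> T \<Longrightarrow> m X > 0" and total: "sum m T = sum m' T"
  shows "transportable m m'"
  using pos total
proof (induction "card {X\<in>T. m X \<noteq> m' X}" arbitrary: m rule: less_induct)
  case less
  show ?case
  proof (cases "\<forall>X\<in>T. m X = m' X")
    case True
    then show ?thesis by (intro transportable_eq) auto
  next
    case False
    have "\<exists>S\<in>T. m' S < m S"
    proof (rule ccontr)
      assume "\<not> ?thesis"
      then have "sum m T < sum m' T"
        using False by (intro sum_strict_mono_ex1) (auto simp: finite_T not_less order_le_less)
      then show False using less.prems(2) by simp
    qed
    then obtain S where S: "S \<in> T" "m' S < m S" by blast
    have "\<exists>Y\<in>T. m Y < m' Y"
    proof (rule ccontr)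
      assume "\<not> ?thesis"
      then have "sum m' T < sum m T"
        using False by (intro sum_strict_mono_ex1) (auto simp: finite_T not_less order_le_less)
      then show False using less.prems(2) by simp
    qed
    then obtain Y where Y: "Y \<in> T" "m Y < m' Y" by blast
    have SY: "S \<noteq> Y" using S Y by auto
    \<comment> \<open>The smaller of the surplus of \<open>S\<close> and the deficit of
      \<open>Y\<close>: at least one of the two cells becomes correct, so the number of wrong cells
      drops, and \<open>S\<close> stays at or above \<open>m' S > 0\<close>.\<close>
    define e where "e = min (m S - m' S) (m' Y - m Y)"
    define n where "n = m(S := m S - e, Y := m Y + e)"
    have e: "0 \<le> e" "e < m S" using S Y pos'[OF S(1)] by (auto simp: e_def)
    have 1: "transportable m n"
      unfolding n_def by (rule transportable_path[OF conn[OF S(1) Y(1)] S(1) SY]) (use less.prems(1) e in auto)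
    have n_other: "n X = m X" if "X \<noteq> S" "X \<noteq> Y" for X using that by (simp add: n_def)
    have nSY: "n S = m S - e" "n Y = m Y + e" using SY by (simp_all add: n_def)
    have 2: "transportable n m'"
    proof (rule less.hyps)
      have "{X\<in>T. n X \<noteq> m' X} \<subset> {X\<in>T. m X \<noteq> m' X}"
      proof
        show "{X\<in>T. n X \<noteq> m' X} \<subseteq> {X\<in>T. m X \<noteq> m' X}"
        proof (rule Collect_mono, rule impI)
          fix X assume X: "X \<in> T \<and> n X \<noteq> m' X"
          show "X \<in> T \<and> m X \<noteq> m' X"
            using X n_other[of X] S Y by (cases "X = S \<or> X = Y") auto
        qed
        have "n S = m' S \<or> n Y = m' Y" unfolding nSY e_def by (simp add: min_def)
        moreover have "S \<in> {X\<in>T. m X \<noteq> m' X}" "Y \<in> {X\<in>T. m X \<noteq> m' X}" using S Y by simp_all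
        ultimately show "{X\<in>T. n X \<noteq> m' X} \<noteq> {X\<in>T. m X \<noteq> m' X}" by (metis (mono_tags, lifting) mem_Collect_eq)
      qed
      then show "card {X\<in>T. n X \<noteq> m' X} < card {X\<in>T. m X \<noteq> m' X}"
        by (intro psubset_card_mono) (simp_all add: finite_T)
      show "n X > 0" if "X \<in> T" for X
        using less.prems(1)[OF that] e n_other[of X] nSY by (cases "X = S \<or> X = Y") auto
      have sumT: "sum f T = f S + f Y + sum f (T - {S,Y})" for f :: "(real^'n) set \<Rightarrow> real"
      proof -
        have "sum f T = sum f {S,Y} + sum f (T - {S,Y})"
          using S Y finite_T by (subst sum.subset_diff[of "{S,Y}"]) auto
        then show ?thesis using SY by simp
      qed
      have "sum n (T - {S,Y}) = sum m (T - {S,Y})" using n_other by (intro sum.cong) auto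
      then show "sum n T = sum m' T" using sumT[of n] sumT[of m] nSY less.prems(2) by simp
    qed
    from 1 2 show ?thesis by (rule transportable_trans)
  qed
qed

text \<open>A segment between generic points of two cells only crosses the partition through facets.\<close>

lemma adjacent_connected:
  assumes conv: "convex (\<Union>T)" and S: "S \<in> T" and R: "R \<in> T"
  shows "adjacent\<^sup>*\<^sup>* S R"
proof (rule ccontr)
  assume notR: "\<not> adjacent\<^sup>*\<^sup>* S R"
  define F where "F = {X\<in>T. adjacent\<^sup>*\<^sup>* S X}"
  obtain x where x: "x \<in> interior S" using interior_cell_nonempty[OF S] by blast
  \<comment> \<open>Pairs meeting in codimension at least two. Together with \<open>x\<close> each
    intersection spans a set of dimension below \<open>CARD('n)\<close>, so \<open>B\<close> is
    negligible and \<open>y\<close> can be chosen in \<open>interior R\<close> outside it.\<close>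
  define I where "I = {(X,Y). X \<in> T \<and> Y \<in> T \<and> aff_dim (X \<inter> Y) \<le> int CARD('n) - 2}"
  have finI: "finite I"
    by (rule finite_subset[of _ "T \<times> T"]) (auto simp: I_def finite_T)
  define B where "B = (\<Union>(X,Y)\<in>I. affine hull (insert x (X \<inter> Y)))"
  have negB: "negligible B"
    unfolding B_def
  proof (rule negligible_Union)
    show "finite ((\<lambda>(X,Y). affine hull (insert x (X \<inter> Y))) ` I)" using finI by simp
    fix A assume "A \<in> (\<lambda>(X,Y). affine hull (insert x (X \<inter> Y))) ` I"
    then obtain X Y where XY: "(X,Y) \<in> I" "A = affine hull (insert x (X \<inter> Y))" by auto
    have "aff_dim (insert x (X \<inter> Y)) \<le> aff_dim (X \<inter> Y) + 1" by (simp add: aff_dim_insert)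
    then have "aff_dim (insert x (X \<inter> Y)) < int CARD('n)" using XY by (auto simp: I_def)
    then have "interior A = {}" using interior_affine_hull_lowdim[of "insert x (X \<inter> Y)"] XY(2) by simp
    then show "negligible A"
      using XY(2) negligible_convex_interior affine_imp_convex affine_affine_hull by metis
  qed
  have "\<not> interior R \<subseteq> B"
    using negB open_not_negligible[OF open_interior interior_cell_nonempty[OF R]] negligible_subset by blast
  then obtain y where y: "y \<in> interior R" "y \<notin> B" by blast
  have clo: "closed (\<Union>G)" if "G \<subseteq> T" for G
    using that finite_T polytope_imp_closed[OF polytope_cell] by (intro closed_Union) (auto intro: finite_subset)
  have "closed_segment x y \<subseteq> \<Union>T"
    using x y S R interior_subset conv by (intro closed_segment_subset) blast+
  then have cover: "closed_segment x y \<subseteq> \<Union>F \<union> \<Union>(T - F)" by blast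
  have "\<Union>F \<inter> closed_segment x y \<noteq> {}" "\<Union>(T - F) \<inter> closed_segment x y \<noteq> {}"
  proof -
    have "S \<in> F" "R \<in> T - F" using S R notR by (auto simp: F_def)
    moreover have "x \<in> S" "y \<in> R" using x y interior_subset by auto
    ultimately show "\<Union>F \<inter> closed_segment x y \<noteq> {}" "\<Union>(T - F) \<inter> closed_segment x y \<noteq> {}"
      using ends_in_segment by blast+
  qed
  \<comment> \<open>The reachable cells and the remaining ones form two closed sets covering a
    connected segment, so they share a point of it.\<close>
  then have "\<Union>F \<inter> \<Union>(T - F) \<inter> closed_segment x y \<noteq> {}"
    using connected_closedD[OF connected_segment(1) _ cover clo clo] unfolding F_def by blast
  then obtain p X Y where p: "p \<in> closed_segment x y" "p \<in> X" "p \<in> Y" "X \<in> F" "Y \<in> T - F" by blast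
  have XY: "X \<in> T" "Y \<in> T" "X \<noteq> Y" using p by (auto simp: F_def)
  have "aff_dim (X \<inter> Y) < aff_dim X"
  proof (rule face_of_aff_dim_lt[OF convex_cell[OF XY(1)] face[OF XY(1,2)]])
    show "X \<inter> Y \<noteq> X"
      using Int_interior_cell[OF XY] interior_cell_nonempty[OF XY(1)] interior_subset[of X] by blast
  qed
  then have "aff_dim (X \<inter> Y) < int CARD('n)" using aff_dim_simplex[OF simplex[OF XY(1)]] by simp
  moreover have "\<not> aff_dim (X \<inter> Y) \<le> int CARD('n) - 2"
  proof
    assume "aff_dim (X \<inter> Y) \<le> int CARD('n) - 2"
    then have hull: "affine hull (insert x (X \<inter> Y)) \<subseteq> B" using XY unfolding B_def I_def by blast
    have "p \<noteq> x"
    proof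
      assume "p = x"
      then have "x \<in> X" "x \<in> Y" using p by auto
      then show False
        using Int_interior_cell[OF S XY(1)] Int_interior_cell[OF S XY(2)] XY(3) x by blast
    qed
    obtain u where u: "p = (1 - u) *\<^sub>R x + u *\<^sub>R y" using p(1) by (auto simp: in_segment)
    then have "u \<noteq> 0" using \<open>p \<noteq> x\<close> by auto
    \<comment> \<open>The target \<open>y\<close> lies on the line through \<open>x\<close> and
      \<open>p\<close>, hence in \<open>B\<close> if \<open>p\<close> belongs to an intersection of
      small dimension.\<close>
    then have "y = (1 - 1/u) *\<^sub>R x + (1/u) *\<^sub>R p"
      unfolding u by (simp add: algebra_simps)
    moreover have "(1 - 1/u) *\<^sub>R x + (1/u) *\<^sub>R p \<in> affine hull (insert x (X \<inter> Y))"
      using p by (intro mem_affine[OF affine_affine_hull]) (auto intro: hull_inc)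
    ultimately show False using hull y(2) by auto
  qed
  ultimately have "adjacent X Y" using XY unfolding adjacent_def by linarith
  then have "Y \<in> F" using p XY unfolding F_def by (auto intro: rtranclp.rtrancl_into_rtrancl)
  then show False using p(5) by blast
qed

end

section \<open>Piecewise linear homeomorphisms between polytopes\<close>

text \<open>The target density is arbitrary and the source density is found from it. In this
  direction pullbacks compose, and at the end the density of \<open>\<omega>2\<close> can be
  inserted for \<open>e\<close>.\<close>

definition PL_equivalent :: "(real^'n) set \<Rightarrow> (real^'n) set \<Rightarrow> bool" where
  "PL_equivalent P Q \<longleftrightarrow> (\<forall>e. \<exists>c f. PL_transport 1 P c Q e f)"

text \<open>The Jacobian determinant does not depend on the cell, even where cells overlap, because two
  affine maps that agree on a nonempty open set are equal.\<close>

lemma PL_equivalentI: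
  fixes P :: "(real^'n) set"
  assumes f: "inj_on f P" "f ` P = Q" and D: "finite D" "\<And>X. X \<in> D \<Longrightarrow> polytope X" "\<Union>D = P"
    and aff: "\<And>X. X \<in> D \<Longrightarrow> \<exists>L b. linear L \<and> det (matrix L) > 0 \<and> (\<forall>x\<in>X. f x = L x + b)"
  shows "PL_equivalent P Q"
  unfolding PL_equivalent_def
proof
  fix e
  let ?c = "\<lambda>x. \<bar>det (matrix (frechet_derivative f (at x)))\<bar> * e (f x)"
  have "PL_transport 1 P ?c Q e f"
    unfolding PL_transport_def
  proof (intro conjI exI[of _ D] f D ballI)
    fix X assume X: "X \<in> D"
    obtain L b where L: "linear L" "det (matrix L) > 0" "\<And>x. x\<in>X \<Longrightarrow> f x = L x + b"
      using aff[OF X] by blast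
    have "\<bar>det (matrix L)\<bar> * e (f x) = ?c x" if x: "x \<in> interior X" for x
    proof -
      have "((\<lambda>x. L x + b) has_derivative L) (at x)"
        using L(1) by (auto intro!: derivative_eq_intros linear_imp_has_derivative)
      then have "(f has_derivative L) (at x)"
      proof (rule has_derivative_transform_within_open[OF _ open_interior x])
        show "L y + b = f y" if "y \<in> interior X" for y using L(3) that interior_subset by (metis subsetD)
      qed
      then have "frechet_derivative f (at x) = L"
        by (rule frechet_derivative_at[symmetric])
      then show ?thesis by simp
    qed
    then show "\<exists>L b. linear L \<and> 1 * det (matrix L) > 0 \<and> (\<forall>x\<in>X. f x = L x + b) \<and>
         (\<forall>x\<in>interior X. \<bar>det (matrix L)\<bar> * e (f x) = ?c x)"
      using L by (intro exI[of _ L] exI[of _ b]) simp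
  qed (use D in auto)
  then show "\<exists>c f. PL_transport 1 P c Q e f" by blast
qed

lemma PL_equivalent_trans:
  assumes "PL_equivalent P Q" "PL_equivalent Q R"
  shows "PL_equivalent P R"
  unfolding PL_equivalent_def
proof
  fix e
  obtain h g where g: "PL_transport 1 Q h R e g" using assms(2) unfolding PL_equivalent_def by blast
  obtain c f where f: "PL_transport 1 P c Q h f" using assms(1) unfolding PL_equivalent_def by blast
  from PL_transport_comp[OF f g] show "\<exists>c f. PL_transport 1 P c R e f" by auto
qed

lemma PL_equivalent_sym:
  assumes "PL_equivalent P Q"
  shows "PL_equivalent Q P"
proof -
  \<comment> \<open>The zero density is a placeholder that yields some map; its inverse is affine on
    cells, and \<open>PL_equivalentI\<close> builds the densities anew.\<close>
  obtain c f where f: "PL_transport 1 P c Q (\<lambda>_. 0) f" using assms unfolding PL_equivalent_def by blast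
  define g where "g = the_inv_into P f"
  have g: "PL_transport 1 Q (\<lambda>_. 0) P c g"
    unfolding g_def by (rule PL_transport_inverse[OF f])
  then obtain D where D: "finite D" "\<forall>X\<in>D. polytope X" "\<Union>D = Q"
      "\<forall>X\<in>D. \<exists>L b. linear L \<and> 1 * det (matrix L) > 0 \<and> (\<forall>x\<in>X. g x = L x + b) \<and>
         (\<forall>x\<in>interior X. \<bar>det (matrix L)\<bar> * c (g x) = 0)"
    unfolding PL_transport_def by (elim conjE exE)
  show ?thesis
  proof (rule PL_equivalentI[OF PL_transport_inj_on[OF g] PL_transport_image[OF g] D(1)])
    fix X assume "X \<in> D"
    with D(4) obtain L b where "linear L" "1 * det (matrix L) > 0" "\<forall>x\<in>X. g x = L x + b" by blast
    then show "\<exists>L b. linear L \<and> det (matrix L) > 0 \<and> (\<forall>x\<in>X. g x = L x + b)" by auto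
  qed (use D in auto)
qed

lemma PL_equivalent_refl:
  assumes "polytope P"
  shows "PL_equivalent P P"
  unfolding PL_equivalent_def using PL_transport_id[OF assms] by blast

text \<open>The room above \<open>x\<close> in direction \<open>e\<close> is a minimum of affine
  functions. Only half-spaces whose normal has a positive component along \<open>e\<close> can be
  left; each gives a remaining distance in units of \<open>e\<close>, with slope -1. Boundedness
  ensures that there is one.\<close>

lemma polytope_room:
  fixes P :: "'a::euclidean_space set"
  assumes P: "polytope P" "P \<noteq> {}" and e: "e \<noteq> 0"
  obtains G where "finite G" "G \<noteq> {}" "\<And>a b. (a,b) \<in> G \<Longrightarrow> a \<bullet> e = -1"
    "\<And>x t. x \<in> P \<Longrightarrow> 0 \<le> t \<Longrightarrow> x + t *\<^sub>R e \<in> P \<longleftrightarrow> (\<forall>(a,b)\<in>G. t \<le> a \<bullet> x + b)"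
proof -
  obtain F where F: "finite F" "P = \<Inter>F" "\<forall>h\<in>F. \<exists>a b. a \<noteq> 0 \<and> h = {x. a \<bullet> x \<le> b}"
    using polytope_imp_polyhedron[OF P(1)] unfolding polyhedron_def by blast
  obtain \<alpha> \<beta> where ab: "\<And>h. h \<in> F \<Longrightarrow> h = {x. \<alpha> h \<bullet> x \<le> \<beta> h}"
    using F(3) by metis
  define H where "H = {h\<in>F. \<alpha> h \<bullet> e > 0}"
  define G where "G = (\<lambda>h. ((- 1 / (\<alpha> h \<bullet> e)) *\<^sub>R \<alpha> h, \<beta> h / (\<alpha> h \<bullet> e))) ` H"
  have mem: "x \<in> P \<longleftrightarrow> (\<forall>h\<in>F. \<alpha> h \<bullet> x \<le> \<beta> h)" for x
    using F(2) ab by auto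
  have le: "t \<le> ((- 1 / (\<alpha> h \<bullet> e)) *\<^sub>R \<alpha> h) \<bullet> x + \<beta> h / (\<alpha> h \<bullet> e) \<longleftrightarrow> \<alpha> h \<bullet> (x + t *\<^sub>R e) \<le> \<beta> h"
    if "h \<in> H" for h x t
  proof -
    have pos: "\<alpha> h \<bullet> e > 0" using that by (simp add: H_def)
    have "((- 1 / (\<alpha> h \<bullet> e)) *\<^sub>R \<alpha> h) \<bullet> x + \<beta> h / (\<alpha> h \<bullet> e) = (\<beta> h - \<alpha> h \<bullet> x) / (\<alpha> h \<bullet> e)"
      by (simp add: diff_divide_distrib)
    then show ?thesis using pos by (simp add: pos_le_divide_eq inner_add_right algebra_simps)
  qed
  have room: "x + t *\<^sub>R e \<in> P \<longleftrightarrow> (\<forall>(a,b)\<in>G. t \<le> a \<bullet> x + b)" if x: "x \<in> P" "0 \<le> t" for x t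
  proof -
    have "\<alpha> h \<bullet> (x + t *\<^sub>R e) \<le> \<beta> h" if "h \<in> F" "h \<notin> H" for h
    proof -
      have "t * (\<alpha> h \<bullet> e) \<le> 0" using that x(2) by (simp add: H_def mult_nonneg_nonpos)
      moreover have "\<alpha> h \<bullet> x \<le> \<beta> h" using x(1) mem that(1) by blast
      ultimately show ?thesis by (simp add: inner_add_right)
    qed
    then have "x + t *\<^sub>R e \<in> P \<longleftrightarrow> (\<forall>h\<in>H. \<alpha> h \<bullet> (x + t *\<^sub>R e) \<le> \<beta> h)"
      unfolding mem H_def by blast
    also have "\<dots> \<longleftrightarrow> (\<forall>(a,b)\<in>G. t \<le> a \<bullet> x + b)"
      unfolding G_def using le by simp
    finally show ?thesis .
  qed
  have "G \<noteq> {}"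
  proof
    assume "G = {}"
    obtain x where x: "x \<in> P" using P(2) by blast
    have all: "x + t *\<^sub>R e \<in> P" if "0 \<le> t" for t using room[OF x that] \<open>G = {}\<close> by simp
    obtain B where B: "\<And>y. y \<in> P \<Longrightarrow> norm y \<le> B" using polytope_imp_bounded[OF P(1)] bounded_iff by blast
    have Bx: "norm x \<le> B" by (rule B[OF x])
    define t where "t = (norm x + B + 1) / norm e"
    have "t \<ge> 0" unfolding t_def using Bx norm_ge_zero[of x] by (intro divide_nonneg_nonneg norm_ge_zero) linarith
    have "norm (t *\<^sub>R e) = norm x + B + 1"
    proof -
      have "0 \<le> norm x + B + 1" using Bx norm_ge_zero[of x] by linarith
      then show ?thesis using e by (simp add: t_def)
    qed
    moreover have "norm (t *\<^sub>R e) \<le> norm (x + t *\<^sub>R e) + norm x"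
      using norm_triangle_ineq4[of "x + t *\<^sub>R e" x] by simp
    ultimately show False using B[OF all[OF \<open>t \<ge> 0\<close>]] by linarith
  qed
  moreover have "finite G" unfolding G_def H_def using F(1) by simp
  moreover have "a \<bullet> e = -1" if "(a,b) \<in> G" for a b
    using that by (auto simp: G_def H_def)
  ultimately show thesis using room that by blast
qed

section \<open>Minima of finitely many affine functions\<close>

definition affine_min :: "('a::real_inner \<times> real) set \<Rightarrow> 'a \<Rightarrow> real" where
  "affine_min G x = Min ((\<lambda>(a,b). a \<bullet> x + b) ` G)"

lemma affine_min_ge_iff:
  assumes "finite G" "G \<noteq> {}"
  shows "t \<le> affine_min G x \<longleftrightarrow> (\<forall>(a,b)\<in>G. t \<le> a \<bullet> x + b)"
  using assms by (auto simp: affine_min_def)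

lemma affine_min_eqI:
  assumes "finite G" "(a,b) \<in> G" "\<And>a' b'. (a',b') \<in> G \<Longrightarrow> a \<bullet> x + b \<le> a' \<bullet> x + b'"
  shows "affine_min G x = a \<bullet> x + b"
  unfolding affine_min_def using assms by (intro Min_eqI) (auto intro!: rev_image_eqI)

lemma affine_min_attained:
  assumes "finite G" "G \<noteq> {}"
  obtains a b where "(a,b) \<in> G" "\<And>a' b'. (a',b') \<in> G \<Longrightarrow> a \<bullet> x + b \<le> a' \<bullet> x + b'"
proof -
  have "affine_min G x \<in> (\<lambda>(a,b). a \<bullet> x + b) ` G"
    unfolding affine_min_def using assms by (intro Min_in) auto
  then obtain a b where ab: "(a,b) \<in> G" "affine_min G x = a \<bullet> x + b" by auto
  then show thesis using that[OF ab(1)] affine_min_ge_iff[OF assms, of "affine_min G x" x] by auto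
qed

lemma affine_min_shift:
  assumes "finite G" "G \<noteq> {}" "\<And>a b. (a,b) \<in> G \<Longrightarrow> a \<bullet> e = -1"
  shows "affine_min G (x + t *\<^sub>R e) = affine_min G x - t"
proof -
  obtain a b where ab: "(a,b) \<in> G" "\<And>a' b'. (a',b') \<in> G \<Longrightarrow> a \<bullet> x + b \<le> a' \<bullet> x + b'"
    using affine_min_attained[OF assms(1,2), where x=x] by blast
  have "affine_min G (x + t *\<^sub>R e) = a \<bullet> (x + t *\<^sub>R e) + b"
    using assms(3) ab by (intro affine_min_eqI[OF assms(1)]) (simp_all add: inner_add_right)
  moreover have "affine_min G x = a \<bullet> x + b"
    by (rule affine_min_eqI[OF assms(1) ab])
  ultimately show ?thesis using assms(3)[OF ab(1)] by (simp add: inner_add_right)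
qed

text \<open>Push \<open>P\<close> onto the larger polytope in the direction \<open>e\<close>: below some level nothing moves,
  above it lengths are stretched by the factor \<open>M\<close>.  A constant factor is enough because each chord
  of the larger polytope in direction \<open>e\<close> is at most \<open>M\<close> times as long as its part in \<open>P\<close>.\<close>

lemma PL_equivalent_insert_point:
  fixes P :: "(real^'n) set"
  assumes P: "polytope P" and p: "p \<in> interior P" and e: "e \<noteq> 0"
  shows "PL_equivalent P (convex hull (insert (p + e) P))"
proof -
  define Q where "Q = convex hull (insert (p + e) P)"
  have convP: "convex P" using P polytope_imp_convex by blast
  have pP: "p \<in> P" using p interior_subset by blast
  have PQ: "P \<subseteq> Q" unfolding Q_def by (meson hull_inc insertCI subsetI)
  have "polytope Q"
  proof -
    obtain V where "finite V" "P = convex hull V" using P unfolding polytope_def by blast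
    then show ?thesis unfolding Q_def polytope_def by (metis finite_insert hull_insert)
  qed
  obtain G where G: "finite G" "G \<noteq> {}" "\<And>a b. (a,b) \<in> G \<Longrightarrow> a \<bullet> e = -1"
    "\<And>x t. x \<in> P \<Longrightarrow> 0 \<le> t \<Longrightarrow> x + t *\<^sub>R e \<in> P \<longleftrightarrow> (\<forall>(a,b)\<in>G. t \<le> a \<bullet> x + b)"
    using polytope_room[OF P _ e] pP by blast
  obtain H where H: "finite H" "H \<noteq> {}" "\<And>a b. (a,b) \<in> H \<Longrightarrow> a \<bullet> e = -1"
    "\<And>x t. x \<in> Q \<Longrightarrow> 0 \<le> t \<Longrightarrow> x + t *\<^sub>R e \<in> Q \<longleftrightarrow> (\<forall>(a,b)\<in>H. t \<le> a \<bullet> x + b)"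
    using polytope_room[OF \<open>polytope Q\<close> _ e] pP PQ by blast
  let ?g = "affine_min G" and ?h = "affine_min H"
  have roomP: "x + t *\<^sub>R e \<in> P \<longleftrightarrow> t \<le> ?g x" if "x \<in> P" "0 \<le> t" for x t
    using G(4)[OF that] affine_min_ge_iff[OF G(1,2)] by simp
  have roomQ: "x + t *\<^sub>R e \<in> Q \<longleftrightarrow> t \<le> ?h x" if "x \<in> Q" "0 \<le> t" for x t
    using H(4)[OF that] affine_min_ge_iff[OF H(1,2)] by simp
  have shiftP: "?g (x + t *\<^sub>R e) = ?g x - t" for x t
    using G(1-3) by (rule affine_min_shift)
  have shiftQ: "?h (x + t *\<^sub>R e) = ?h x - t" for x t
    using H(1-3) by (rule affine_min_shift)
  have gP: "0 \<le> ?g x" if "x \<in> P" for x using roomP[OF that, of 0] that by simp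
  have hQ: "0 \<le> ?h x" if "x \<in> Q" for x using roomQ[OF that, of 0] that by simp
  obtain r where r: "r > 0" "cball p r \<subseteq> P" using p mem_interior_cball by blast
  \<comment> \<open>Small enough for both \<open>p + \<kappa> *\<^sub>R e\<close> and
    \<open>p - \<kappa> *\<^sub>R e\<close> to stay in the ball around \<open>p\<close>.\<close>
  define \<kappa> where "\<kappa> = min 1 (r / norm e)"
  have \<kappa>: "0 < \<kappa>" "\<kappa> \<le> 1" "\<kappa> * norm e \<le> r" using r e by (auto simp: \<kappa>_def min_def field_simps)
  have near: "p + \<kappa> *\<^sub>R e \<in> P" "p - \<kappa> *\<^sub>R e \<in> P" using r(2) \<kappa> by (auto simp: subset_iff dist_norm)
  \<comment> \<open>In a convex combination giving \<open>p + e\<close> the weight \<open>l\<close>,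
    these two points may replace \<open>p + e\<close>; the result lies in \<open>P\<close>, lowered
    by \<open>l * (1 - \<kappa>)\<close> or \<open>l * (1 + \<kappa>)\<close> along
    \<open>e\<close>. So below an upper end a chord of length \<open>l * (1 + \<kappa>)\<close> has
    at least \<open>2 * l * \<kappa>\<close> in \<open>P\<close>, and \<open>M\<close> is the
    quotient.\<close>
  define M where "M = (1 + \<kappa>) / (2 * \<kappa>)"
  have M: "1 \<le> M" "M * (2 * \<kappa>) = 1 + \<kappa>" using \<kappa> by (auto simp: M_def field_simps)
  have chord: "\<exists>l\<ge>0. q - (l * (1 - \<kappa>)) *\<^sub>R e \<in> P \<and> q - (l * (1 + \<kappa>)) *\<^sub>R e \<in> P" if "q \<in> Q" for q
  proof -
    obtain l v x where l: "l \<ge> 0" "v \<ge> 0" "l + v = 1" "x \<in> P" "q = l *\<^sub>R (p + e) + v *\<^sub>R x"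
    proof -
      have "P \<noteq> {}" "convex hull P = P" using pP convP by (auto simp: hull_same)
      then have "Q = {z. \<exists>u\<ge>0. \<exists>v\<ge>0. \<exists>y. u + v = 1 \<and> y \<in> P \<and> z = u *\<^sub>R (p + e) + v *\<^sub>R y}"
        unfolding Q_def using convex_hull_insert[of P "p + e"] by simp
      then show thesis using \<open>q \<in> Q\<close> that by blast
    qed
    have "q - (l * (1 - \<kappa>)) *\<^sub>R e = l *\<^sub>R (p + \<kappa> *\<^sub>R e) + v *\<^sub>R x"
      "q - (l * (1 + \<kappa>)) *\<^sub>R e = l *\<^sub>R (p - \<kappa> *\<^sub>R e) + v *\<^sub>R x"
      unfolding l(5) by (simp_all add: algebra_simps)
    then show ?thesis using l(1) convexD[OF convP near(1) l(4,1-3)] convexD[OF convP near(2) l(4,1-3)] by auto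
  qed
  \<comment> \<open>With \<open>?g\<close> and \<open>?h\<close> measuring the room above a point in
    \<open>P\<close> and in \<open>Q\<close>, the map satisfies
    \<open>?h (f x) = min (?h x) (M * ?g x)\<close>: points stay until the stretched room in
    \<open>P\<close> is the smaller one.\<close>
  define \<Delta> where "\<Delta> x = ?h x - M * ?g x" for x
  define f where "f x = x + max 0 (\<Delta> x) *\<^sub>R e" for x
  have \<Delta>_shift: "\<Delta> (x + t *\<^sub>R e) = \<Delta> x + (M - 1) * t" for x t
    by (simp add: \<Delta>_def shiftP shiftQ algebra_simps)
  have f_shift: "f (x + t *\<^sub>R e) = x + max t (\<Delta> x + M * t) *\<^sub>R e" for x t
  proof -
    have "t + max 0 (\<Delta> x + (M - 1) * t) = max t (\<Delta> x + M * t)" by (simp add: max_def algebra_simps)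
    then show ?thesis unfolding f_def \<Delta>_shift by (metis add.assoc scaleR_left_distrib)
  qed
  have inj: "inj_on f P"
  proof (rule inj_onI)
    fix x y assume eq: "f x = f y"
    define t where "t = max 0 (\<Delta> x) - max 0 (\<Delta> y)"
    have y: "y = x + t *\<^sub>R e" using eq by (simp add: f_def t_def algebra_simps)
    have "x + max 0 (\<Delta> x) *\<^sub>R e = x + max t (\<Delta> x + M * t) *\<^sub>R e"
      using eq f_shift[of x t] unfolding y by (simp add: f_def)
    then have mm: "max 0 (\<Delta> x) = max t (\<Delta> x + M * t)" using e by simp
    have "t = 0"
    proof (rule ccontr)
      assume "t \<noteq> 0"
      then consider "t > 0" | "t < 0" by linarith
      then show False
      proof cases
        case 1
        then have "M * t > 0" using M by simp
        with 1 mm show False by linarith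
      next
        case 2
        then have "M * t < 0" using M by (simp add: mult_pos_neg)
        with 2 mm show False by linarith
      qed
    qed
    then show "x = y" using y by simp
  qed
  have "f ` P \<subseteq> Q"
  proof
    fix z assume "z \<in> f ` P"
    then obtain x where x: "x \<in> P" "z = f x" by blast
    have "x \<in> Q" using x PQ by blast
    moreover have "\<Delta> x \<le> ?h x" using gP[OF x(1)] M by (simp add: \<Delta>_def)
    ultimately show "z \<in> Q" using roomQ[of x "max 0 (\<Delta> x)"] hQ[of x] x(2) by (simp add: f_def)
  qed
  moreover have "Q \<subseteq> f ` P"
  proof
    fix z assume z: "z \<in> Q"
    \<comment> \<open>The chord estimate at the upper end of the line through \<open>z\<close>
      yields a point \<open>x\<close> of \<open>P\<close> on that line with
      \<open>\<Delta> x \<le> 0\<close>, which \<open>f\<close> does not move.\<close>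
    define top where "top = z + ?h z *\<^sub>R e"
    have "top \<in> Q" using roomQ[OF z hQ[OF z]] by (simp add: top_def)
    then obtain l where l: "l \<ge> 0" "top - (l * (1 - \<kappa>)) *\<^sub>R e \<in> P" "top - (l * (1 + \<kappa>)) *\<^sub>R e \<in> P"
      using chord by blast
    define x where "x = top - (l * (1 + \<kappa>)) *\<^sub>R e"
    have xP: "x \<in> P" using l(3) by (simp add: x_def)
    define s where "s = l * (1 + \<kappa>) - ?h z"
    have zx: "z = x + s *\<^sub>R e" by (simp add: x_def s_def top_def algebra_simps)
    have hx: "?h x = l * (1 + \<kappa>)"
      using shiftQ[of x s] unfolding zx[symmetric] by (simp add: s_def)
    have "x + (2 * l * \<kappa>) *\<^sub>R e \<in> P"
    proof -
      have eq: "l * (1 - \<kappa>) = l * (1 + \<kappa>) - 2 * l * \<kappa>" by (simp add: algebra_simps)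
      have "x + (2 * l * \<kappa>) *\<^sub>R e = top - (l * (1 - \<kappa>)) *\<^sub>R e"
        by (simp only: x_def eq scaleR_left_diff_distrib diff_diff_eq2 diff_add_eq)
      then show ?thesis using l(2) by simp
    qed
    then have "2 * l * \<kappa> \<le> ?g x" using roomP[OF xP, of "2 * l * \<kappa>"] l(1) \<kappa> by simp
    then have "M * (2 * l * \<kappa>) \<le> M * ?g x" using M by (intro mult_left_mono) auto
    moreover have "M * (2 * l * \<kappa>) = l * (1 + \<kappa>)" using M(2) by (metis mult.assoc mult.commute)
    ultimately have \<Delta>x: "\<Delta> x \<le> 0" unfolding \<Delta>_def hx by linarith
    show "z \<in> f ` P"
    proof (cases "s \<ge> 0")
      case True
      \<comment> \<open>Solves \<open>max t (\<Delta> x + M * t) = s\<close>: a maximum of two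
        increasing functions reaches \<open>s\<close> at the smaller of their two solutions.\<close>
      define t where "t = min s ((s - \<Delta> x) / M)"
      have Mt: "M * t = min (M * s) (s - \<Delta> x)"
        using M by (simp add: t_def min_def field_simps)
      have "0 \<le> t" using True \<Delta>x M by (simp add: t_def)
      have "s \<le> ?h x" using hx hQ[OF z] by (simp add: s_def)
      then have "M * t \<le> M * ?g x" unfolding Mt \<Delta>_def by linarith
      then have "t \<le> ?g x" using M by simp
      then have mem: "x + t *\<^sub>R e \<in> P" using roomP[OF xP \<open>0 \<le> t\<close>] by simp
      have "max t (\<Delta> x + M * t) = s"
      proof (cases "s \<le> (s - \<Delta> x) / M")
        case True
        then have "t = s" "M * s \<le> s - \<Delta> x" using M by (simp_all add: t_def field_simps)
        then show ?thesis by simp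
      next
        case False
        then have "t = (s - \<Delta> x) / M" "t \<le> s" by (simp_all add: t_def)
        then have "M * t = s - \<Delta> x" using M by simp
        then show ?thesis using \<open>t \<le> s\<close> by simp
      qed
      then have "f (x + t *\<^sub>R e) = z" unfolding f_shift zx by simp
      then show ?thesis using mem by blast
    next
      \<comment> \<open>Now \<open>z\<close> lies between \<open>x\<close> and a point of
        \<open>P\<close> further down, hence in \<open>P\<close>. As \<open>\<Delta>\<close> is
        nondecreasing along \<open>e\<close>, it is not moved either.\<close>
      case False
      obtain l' where l': "l' \<ge> 0" "z - (l' * (1 + \<kappa>)) *\<^sub>R e \<in> P" using chord[OF z] by blast
      let ?u = "l' * (1 + \<kappa>)"
      have u: "?u \<ge> 0" using l' \<kappa> by simp
      have "(z - ?u *\<^sub>R e) + (?u - s) *\<^sub>R e \<in> P" using xP by (simp add: zx algebra_simps)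
      then have "?u - s \<le> ?g (z - ?u *\<^sub>R e)" using roomP[OF l'(2), of "?u - s"] u False by simp
      then have "(z - ?u *\<^sub>R e) + ?u *\<^sub>R e \<in> P" using roomP[OF l'(2) u] False by simp
      then have zP: "z \<in> P" by simp
      have "(M - 1) * s \<le> 0" using False M by (simp add: mult_nonneg_nonpos)
      then have "\<Delta> z \<le> 0" unfolding zx \<Delta>_shift using \<Delta>x by simp
      then have "f z = z" by (simp add: f_def)
      then show ?thesis using zP by force
    qed
  qed
  ultimately have img: "f ` P = Q" by blast
  let ?val = "\<lambda>ab x. fst ab \<bullet> x + snd ab"
  \<comment> \<open>The region where \<open>g\<close> and \<open>h\<close> realise the two minima,
    so that \<open>\<Delta>\<close> is affine on it; its sign separates \<open>Lo\<close> from
    \<open>Up\<close>.\<close>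
  define C where "C g h = P \<inter> {x. \<forall>i\<in>G. (fst g - fst i) \<bullet> x \<le> snd i - snd g}
     \<inter> {x. \<forall>i\<in>H. (fst h - fst i) \<bullet> x \<le> snd i - snd h}" for g h
  have C_iff: "x \<in> C g h \<longleftrightarrow> x \<in> P \<and> (\<forall>i\<in>G. ?val g x \<le> ?val i x) \<and> (\<forall>i\<in>H. ?val h x \<le> ?val i x)" for x g h
    by (auto simp: C_def inner_diff_left algebra_simps)
  define Lo where "Lo g h = C g h \<inter> {x. (fst h - M *\<^sub>R fst g) \<bullet> x \<le> M * snd g - snd h}" for g h
  define Up where "Up g h = C g h \<inter> {x. (fst h - M *\<^sub>R fst g) \<bullet> x \<ge> M * snd g - snd h}" for g h
  define D where "D = (\<lambda>(g,h). Lo g h) ` (G \<times> H) \<union> (\<lambda>(g,h). Up g h) ` (G \<times> H)"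
  have polyC: "polytope (C g h)" for g h
    unfolding C_def by (intro polytope_Int_polyhedron P polyhedron_Int_halfspaces G(1) H(1))
  have val: "\<Delta> x = (fst h - M *\<^sub>R fst g) \<bullet> x + (snd h - M * snd g)" if "g \<in> G" "h \<in> H" "x \<in> C g h" for g h x
  proof -
    have "?g x = ?val g x"
      using that C_iff[of x g h] by (intro affine_min_eqI[OF G(1)]) (force simp: prod_eq_iff)+
    moreover have "?h x = ?val h x"
      using that C_iff[of x g h] by (intro affine_min_eqI[OF H(1)]) (force simp: prod_eq_iff)+
    ultimately show ?thesis by (simp add: \<Delta>_def inner_diff_left algebra_simps)
  qed
  have "PL_equivalent P Q"
  proof (rule PL_equivalentI[OF inj img, of D])
    show "finite D" unfolding D_def using G(1) H(1) by simp
    show "polytope X" if "X \<in> D" for X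
      using that polytope_Int_polyhedron[OF polyC polyhedron_halfspace_le]
        polytope_Int_polyhedron[OF polyC polyhedron_halfspace_ge]
      unfolding D_def Lo_def Up_def by auto
    show "\<Union>D = P"
    proof
      show "\<Union>D \<subseteq> P" unfolding D_def Lo_def Up_def C_def by auto
      show "P \<subseteq> \<Union>D"
      proof
        fix x assume x: "x \<in> P"
        obtain a b where g: "(a,b) \<in> G" "\<And>a' b'. (a',b') \<in> G \<Longrightarrow> a \<bullet> x + b \<le> a' \<bullet> x + b'"
          using affine_min_attained[OF G(1,2), where x=x] by blast
        obtain c d where h: "(c,d) \<in> H" "\<And>a' b'. (a',b') \<in> H \<Longrightarrow> c \<bullet> x + d \<le> a' \<bullet> x + b'"
          using affine_min_attained[OF H(1,2), where x=x] by blast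
        have "x \<in> C (a,b) (c,d)" unfolding C_iff using x g h by auto
        then have "x \<in> Lo (a,b) (c,d) \<union> Up (a,b) (c,d)" unfolding Lo_def Up_def by auto
        then show "x \<in> \<Union>D" using g(1) h(1) unfolding D_def by force
      qed
    qed
    fix X assume "X \<in> D"
    then obtain g h where gh: "g \<in> G" "h \<in> H" "X = Lo g h \<or> X = Up g h" unfolding D_def by auto
    show "\<exists>L b. linear L \<and> det (matrix L) > 0 \<and> (\<forall>x\<in>X. f x = L x + b)"
      using gh(3)
    proof
      assume X: "X = Lo g h"
      have "f x = x + 0" if "x \<in> X" for x
        using that val[OF gh(1,2), of x] unfolding X Lo_def by (simp add: f_def)
      moreover have "matrix (\<lambda>x. x) = (mat 1 :: real^'n^'n)"
        using matrix_id_mat_1 by (simp add: id_def)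
      ultimately show ?thesis by (intro exI[of _ "\<lambda>x. x"] exI[of _ 0]) (simp add: linear_ident)
    next
      assume X: "X = Up g h"
      let ?l = "fst h - M *\<^sub>R fst g"
      let ?L = "\<lambda>x. x + (?l \<bullet> x) *\<^sub>R e"
      have "fst g \<bullet> e = -1" "fst h \<bullet> e = -1"
        using G(3)[of "fst g" "snd g"] H(3)[of "fst h" "snd h"] gh by simp_all
      \<comment> \<open>Both gradients have slope -1 along \<open>e\<close>, so the displacement has
        slope \<open>M - 1\<close>.\<close>
      then have "det (matrix ?L) = M"
        unfolding det_identity_plus_rank_one by (simp add: inner_diff_left)
      moreover have "linear ?L"
        by (rule linearI) (simp_all add: algebra_simps inner_add_right)
      moreover have "f x = ?L x + (snd h - M * snd g) *\<^sub>R e" if "x \<in> X" for x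
      proof -
        have "0 \<le> \<Delta> x" "\<Delta> x = ?l \<bullet> x + (snd h - M * snd g)"
          using that val[OF gh(1,2), of x] unfolding X Up_def by auto
        then show ?thesis by (simp only: f_def max_absorb2 scaleR_left_distrib add.assoc)
      qed
      ultimately show ?thesis using M(1)
        by (intro exI[of _ ?L] exI[of _ "(snd h - M * snd g) *\<^sub>R e"]) simp
    qed
  qed
  then show ?thesis by (simp add: Q_def)
qed

lemma PL_equivalent_hull_Un:
  fixes P :: "(real^'n) set"
  assumes P: "polytope P" "interior P \<noteq> {}" and "finite W"
  shows "PL_equivalent P (convex hull (P \<union> W))"
  using \<open>finite W\<close>
proof (induction W)
  case empty
  then show ?case using PL_equivalent_refl[OF P(1)] polytope_imp_convex[OF P(1)] by (simp add: hull_same)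
next
  case (insert w W)
  let ?R = "convex hull (P \<union> W)"
  have R: "convex hull (P \<union> insert w W) = convex hull (insert w ?R)"
    using hull_insert[of convex w "P \<union> W"] by simp
  have polyR: "polytope ?R"
  proof -
    obtain V where "finite V" "P = convex hull V" using P(1) unfolding polytope_def by blast
    then have "?R = convex hull (V \<union> W)" by (metis hull_Un_left)
    then show ?thesis using \<open>finite V\<close> insert.hyps(1) by (simp add: polytope_convex_hull)
  qed
  obtain p where "p \<in> interior P" using P(2) by blast
  then have p: "p \<in> interior ?R"
    using interior_mono[of P ?R] hull_subset[of "P \<union> W" convex] by blast
  have "PL_equivalent ?R (convex hull (insert w ?R))"
  proof (cases "w = p")
    case True
    then have "w \<in> ?R" using p interior_subset by blast
    then have "convex hull (insert w ?R) = ?R" by (simp only: insert_absorb hull_hull)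
    then show ?thesis using PL_equivalent_refl[OF polyR] by simp
  next
    case False
    then show ?thesis using PL_equivalent_insert_point[OF polyR p, of "w - p"] by simp
  qed
  with insert.IH show ?case unfolding R by (rule PL_equivalent_trans)
qed

lemma PL_equivalent_polytopes:
  fixes P Q :: "(real^'n) set"
  assumes "polytope P" "interior P \<noteq> {}" "polytope Q" "interior Q \<noteq> {}"
  shows "PL_equivalent P Q"
proof -
  obtain V where V: "finite V" "P = convex hull V" using assms(1) unfolding polytope_def by blast
  obtain W where W: "finite W" "Q = convex hull W" using assms(3) unfolding polytope_def by blast
  have "convex hull (P \<union> W) = convex hull (V \<union> W)" "convex hull (Q \<union> V) = convex hull (V \<union> W)"
    unfolding V(2) W(2) using hull_Un_left by (metis, metis Un_commute)
  then have "PL_equivalent P (convex hull (V \<union> W))" "PL_equivalent Q (convex hull (V \<union> W))"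
    using PL_equivalent_hull_Un[OF assms(1,2) W(1)] PL_equivalent_hull_Un[OF assms(3,4) V(1)] by auto
  then show ?thesis using PL_equivalent_trans PL_equivalent_sym by blast
qed

section \<open>Volume-preserving maps\<close>

text \<open>Cut \<open>P\<close> along all hyperplanes bounding polytopes of \<open>M\<close>, then
  triangulate. Each simplex lies on one side of each hyperplane, so it is contained in every
  \<open>X\<close> of \<open>M\<close> that meets its interior. Quantifying over \<open>N\<close>
  lets one triangulation refine several covers, whose members may overlap.\<close>

lemma triangulation_refining:
  fixes P :: "(real^'n) set"
  assumes P: "polytope P" "interior P \<noteq> {}" and M: "finite M" "\<forall>X\<in>M. polytope X"
  obtains T where "triangulation T" "\<Union>T = P" "\<forall>t\<in>T. int CARD('n) simplex t"
    "\<forall>N\<subseteq>M. \<Union>N = P \<longrightarrow> (\<forall>t\<in>T. \<exists>X\<in>N. t \<subseteq> X)"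
proof -
  have dimP: "aff_dim P = int CARD('n)"
    using interior_nonempty_iff_aff_dim[OF polytope_imp_convex[OF P(1)]] P(2) by simp
  have "\<exists>H. finite H \<and> (\<forall>(a,b)\<in>H. a \<noteq> 0) \<and> X = {x. \<forall>(a,b)\<in>H. a \<bullet> x \<le> b}" if X: "X \<in> M" for X
  proof -
    obtain F where F: "finite F" "X = \<Inter>F" "\<forall>h\<in>F. \<exists>a b. a \<noteq> 0 \<and> h = {x. a \<bullet> x \<le> b}"
      using polytope_imp_polyhedron[OF M(2)[rule_format, OF X]] unfolding polyhedron_def by blast
    obtain \<alpha> \<beta> where ab: "\<And>h. h \<in> F \<Longrightarrow> \<alpha> h \<noteq> 0 \<and> h = {x. \<alpha> h \<bullet> x \<le> \<beta> h}"
      using F(3) by metis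
    have "X = {x. \<forall>(a,b)\<in>(\<lambda>h. (\<alpha> h, \<beta> h)) ` F. a \<bullet> x \<le> b}"
      unfolding F(2) using ab by auto
    then show ?thesis using F(1) ab by (intro exI[of _ "(\<lambda>h. (\<alpha> h, \<beta> h)) ` F"]) auto
  qed
  then have "\<forall>X\<in>M. \<exists>H. finite H \<and> (\<forall>(a,b)\<in>H. a \<noteq> 0) \<and> X = {x. \<forall>(a,b)\<in>H. a \<bullet> x \<le> b}" by blast
  from bchoice[OF this] obtain H where
    "\<forall>X\<in>M. finite (H X) \<and> (\<forall>(a,b)\<in>H X. a \<noteq> 0) \<and> X = {x. \<forall>(a,b)\<in>H X. a \<bullet> x \<le> b}" ..
  then have H: "\<And>X. X \<in> M \<Longrightarrow> finite (H X)" "\<And>X a b. X \<in> M \<Longrightarrow> (a,b) \<in> H X \<Longrightarrow> a \<noteq> 0"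
    "\<And>X. X \<in> M \<Longrightarrow> X = {x. \<forall>(a,b)\<in>H X. a \<bullet> x \<le> b}"
    by fast+
  define I where "I = \<Union>(H ` M)"
  have finI: "finite I" using M(1) H(1) by (simp add: I_def)
  have PP: "X \<in> {P} \<Longrightarrow> polytope X" "X \<in> {P} \<Longrightarrow> aff_dim X \<le> int CARD('n)"
    "X \<in> {P} \<Longrightarrow> Y \<in> {P} \<Longrightarrow> X \<inter> Y face_of X" for X Y
    using P(1) dimP polytope_imp_convex face_of_refl by auto
  obtain G where G: "\<Union>G = \<Union>{P}" "finite G" "\<forall>X\<in>G. polytope X" "\<forall>X\<in>G. \<forall>Y\<in>G. X \<inter> Y face_of X"
    "\<forall>X\<in>G. \<forall>x\<in>X. \<forall>y\<in>X. \<forall>a b. (a,b) \<in> I \<longrightarrow> a \<bullet> x \<le> b \<and> a \<bullet> y \<le> b \<or> a \<bullet> x \<ge> b \<and> a \<bullet> y \<ge> b"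
    using cell_subdivision_lemma[of "{P}" "int CARD('n)" I, OF _ PP finI] by auto
  \<comment> \<open>The full-dimensional cells alone already cover \<open>P\<close>, and they keep
    the simplices full-dimensional.\<close>
  define G' where "G' = {C\<in>G. aff_dim C = aff_dim P}"
  have UG': "\<Union>G' = P"
    unfolding G'_def using G P(1)
    by (intro convex_Union_fulldim_cells) (auto simp: polytope_imp_closed polytope_imp_convex)
  obtain T where T: "triangulation T" "\<And>k. k \<in> T \<Longrightarrow> aff_dim k = int CARD('n)" "\<Union>T = \<Union>G'"
    "\<And>k. k \<in> T \<Longrightarrow> \<exists>C. C \<in> G' \<and> k \<subseteq> C"
  proof (rule fine_triangular_subdivision_of_cell_complex[of 1 G' "int CARD('n)"])
    show "finite G'" "\<And>C. C \<in> G' \<Longrightarrow> polytope C" "\<And>C. C \<in> G' \<Longrightarrow> aff_dim C = int CARD('n)"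
      "\<And>C D. C \<in> G' \<Longrightarrow> D \<in> G' \<Longrightarrow> C \<inter> D face_of C"
      using G dimP by (auto simp: G'_def)
  qed auto
  have simplexT: "int CARD('n) simplex t" if t: "t \<in> T" for t
  proof -
    obtain n where "n simplex t" using T(1) t unfolding triangulation_def by blast
    then show ?thesis using aff_dim_simplex[of n t] T(2)[OF t] by simp
  qed
  have int_ne: "interior t \<noteq> {}" if "t \<in> T" for t
    using interior_nonempty_iff_aff_dim[OF convex_simplex[OF simplexT[OF that]]] T(2)[OF that] by simp
  \<comment> \<open>If some point violated an inequality of \<open>X\<close>, the whole simplex
    would lie on the wrong side of that hyperplane, and its interior point \<open>y\<close> strictly
    so.\<close>
  have sub: "t \<subseteq> X" if t: "t \<in> T" and X: "X \<in> M" and y: "y \<in> interior t" "y \<in> X" for t X y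
  proof
    fix x assume x: "x \<in> t"
    obtain C where C: "C \<in> G" "t \<subseteq> C" using T(4)[OF t] unfolding G'_def by blast
    have "a \<bullet> x \<le> b" if ab: "(a,b) \<in> H X" for a b
    proof (rule ccontr)
      assume gt: "\<not> a \<bullet> x \<le> b"
      have "(a,b) \<in> I" using ab X unfolding I_def by blast
      then have "b \<le> a \<bullet> z" if "z \<in> t" for z
        using G(5) C x that gt by (meson subsetD)
      then have "b < a \<bullet> y" using interior_ge_hyperplane[OF H(2)[OF X ab] y(1)] by blast
      moreover have "a \<bullet> y \<le> b" using H(3)[OF X] y(2) ab by blast
      ultimately show False by simp
    qed
    then show "x \<in> X" using H(3)[OF X] by blast
  qed
  have UT: "\<Union>T = P" using T(3) UG' by simp
  have "\<exists>X\<in>N. t \<subseteq> X" if N: "N \<subseteq> M" "\<Union>N = P" and t: "t \<in> T" for N t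
  proof -
    obtain y where y: "y \<in> interior t" using int_ne[OF t] by blast
    then have "y \<in> P" using interior_subset UT t by blast
    then obtain X where X: "X \<in> N" "y \<in> X" using N(2) by blast
    then have "t \<subseteq> X" using sub[OF t _ y] N(1) by blast
    then show ?thesis using X(1) by blast
  qed
  then show thesis using that[OF T(1) UT] simplexT by simp
qed

lemma simplicial_partition_triangulation:
  fixes T :: "(real^'n) set set"
  assumes "triangulation T" "\<And>t. t \<in> T \<Longrightarrow> int CARD('n) simplex t"
  shows "simplicial_partition T"
  using assms unfolding triangulation_def by unfold_locales auto

section \<open>Integrals of piecewise constant densities\<close>

lemma (in simplicial_partition) negligible_Int:
  assumes "X \<in> T" "Y \<in> T" "X \<noteq> Y"
  shows "negligible (X \<inter> Y)"
proof (rule negligible_subset)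
  show "negligible (frontier X)" by (rule negligible_convex_frontier[OF convex_cell[OF assms(1)]])
  show "X \<inter> Y \<subseteq> frontier X"
    using Int_interior_cell[OF assms] closure_subset[of X] unfolding frontier_def by blast
qed

lemma has_integral_const_interior:
  fixes X :: "(real^'n) set"
  assumes X: "polytope X" and c: "\<And>x. x \<in> interior X \<Longrightarrow> c x = k"
  shows "(c has_integral k * measure lebesgue X) X"
proof -
  have "((\<lambda>_. 1) has_integral measure lebesgue X) X"
    using lmeasurable_polytope[OF X] by (simp add: lmeasure_integral integrable_on_const integrable_integral)
  then have "((\<lambda>_. k * 1) has_integral k * measure lebesgue X) X"
    by (rule has_integral_mult_right)
  moreover have "negligible (frontier X)"
    using X polytope_imp_convex negligible_convex_frontier by blast
  ultimately show ?thesis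
  proof (rule has_integral_spike[rotated 2])
    show "c x = k * 1" if "x \<in> X - frontier X" for x
      using that c[of x] closure_subset[of X] by (simp add: frontier_def subset_iff)
  qed
qed

definition piecewise_constant_density :: "(real^'n) set \<Rightarrow> (real^'n \<Rightarrow> real) \<Rightarrow> bool" where
  "piecewise_constant_density P c \<longleftrightarrow> (\<exists>D. finite D \<and> (\<forall>X\<in>D. polytope X) \<and> \<Union>D = P \<and>
     (\<forall>X\<in>D. \<exists>k>0. \<forall>x\<in>interior X. c x = k))"

text \<open>Change of variables simplex by simplex: a common refinement makes \<open>g\<close>
  affine on each simplex and \<open>e\<close> constant on its interior. The image has
  \<open>det (matrix L)\<close> times the volume and the density divided by the same number, so each
  mass is preserved.\<close>

lemma PL_transport_density:
  fixes P Q :: "(real^'n) set"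
  assumes Q: "polytope Q" "interior Q \<noteq> {}" and g: "PL_transport 1 Q e P c g"
    and e: "piecewise_constant_density Q e"
  shows "piecewise_constant_density P c" and "integral P c = integral Q e"
proof -
  obtain E where E: "finite E" "\<forall>X\<in>E. polytope X" "\<Union>E = Q"
    "\<forall>X\<in>E. \<exists>L b. linear L \<and> 1 * det (matrix L) > 0 \<and> (\<forall>x\<in>X. g x = L x + b) \<and>
         (\<forall>x\<in>interior X. \<bar>det (matrix L)\<bar> * c (g x) = e x)"
    using g unfolding PL_transport_def by (elim conjE exE)
  obtain D where D: "finite D" "\<forall>X\<in>D. polytope X" "\<Union>D = Q" "\<forall>X\<in>D. \<exists>k>0. \<forall>x\<in>interior X. e x = k"
    using e unfolding piecewise_constant_density_def by (elim conjE exE)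
  have fin: "finite (D \<union> E)" and poly: "\<forall>X\<in>D \<union> E. polytope X"
    using D(1,2) E(1,2) by auto
  obtain T where T': "triangulation T" "\<Union>T = Q" "\<forall>t\<in>T. int CARD('n) simplex t"
    "\<forall>N\<subseteq>D \<union> E. \<Union>N = Q \<longrightarrow> (\<forall>t\<in>T. \<exists>X\<in>N. t \<subseteq> X)"
    by (rule triangulation_refining[OF Q fin poly])
  note T = T'(1,2) T'(3,4)[rule_format]
  interpret simplicial_partition T by (rule simplicial_partition_triangulation[OF T(1,3)])
  have gQ: "g ` Q = P" "inj_on g Q" using g PL_transport_image PL_transport_inj_on by blast+
  have piece: "\<exists>k>0. \<exists>L b. linear L \<and> det (matrix L) > 0 \<and> (\<forall>x\<in>t. g x = L x + b) \<and>
      (\<forall>x\<in>interior t. e x = k) \<and> (\<forall>x\<in>interior (g ` t). c x = k / det (matrix L))" if t: "t \<in> T" for t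
  proof -
    obtain X where X: "X \<in> D" "t \<subseteq> X" using T(4)[of D] D(3) t by auto
    obtain Y where Y: "Y \<in> E" "t \<subseteq> Y" using T(4)[of E] E(3) t by auto
    obtain k where k: "k > 0" "\<And>x. x \<in> interior X \<Longrightarrow> e x = k" using D(4) X(1) by blast
    obtain L b where L: "linear L" "det (matrix L) > 0" "\<And>x. x \<in> Y \<Longrightarrow> g x = L x + b"
      "\<And>x. x \<in> interior Y \<Longrightarrow> \<bar>det (matrix L)\<bar> * c (g x) = e x"
      using E(4) Y(1) by fastforce
    have nz: "det (matrix L) \<noteq> 0" using L(2) by simp
    have ek: "e x = k" if "x \<in> interior t" for x using that k(2) interior_mono[OF X(2)] by blast
    have "c x = k / det (matrix L)" if x: "x \<in> interior (g ` t)" for x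
    proof -
      have "g ` t = (\<lambda>x. L x + b) ` t" using L(3) Y(2) by (intro image_cong) auto
      then obtain y where y: "y \<in> interior t" "x = L y + b"
        using x interior_affine_image[OF L(1) nz, of b t] by auto
      then have "y \<in> interior Y" using interior_mono[OF Y(2)] by blast
      moreover have "x = g y" using y L(3)[of y] \<open>y \<in> interior Y\<close> interior_subset[of Y] by auto
      ultimately show ?thesis using L(2,4) ek[OF y(1)] by (simp add: field_simps)
    qed
    then show ?thesis using k(1) L(1,2) L(3) Y(2) ek by (intro exI[of _ k] conjI exI[of _ L] exI[of _ b]) auto
  qed
  from bchoice[OF ballI[OF piece]]
  obtain k where "\<forall>t\<in>T. k t > 0 \<and> (\<exists>L b. linear L \<and> det (matrix L) > 0 \<and> (\<forall>x\<in>t. g x = L x + b) \<and>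
      (\<forall>x\<in>interior t. e x = k t) \<and> (\<forall>x\<in>interior (g ` t). c x = k t / det (matrix L)))" ..
  note k = bspec[OF this]
  have gt: "polytope (g ` t)" "\<exists>d>0. \<forall>x\<in>interior (g ` t). c x = d"
    "(c has_integral k t * measure lebesgue t) (g ` t)"
    "\<And>A. A \<subseteq> t \<Longrightarrow> negligible A \<Longrightarrow> negligible (g ` A)" if t: "t \<in> T" for t
  proof -
    obtain L b where L: "linear L" "det (matrix L) > 0" "\<And>x. x\<in>t \<Longrightarrow> g x = L x + b"
      "\<And>x. x\<in>interior (g ` t) \<Longrightarrow> c x = k t / det (matrix L)" using k[OF t] by blast
    have eq: "g ` A = (\<lambda>x. L x + b) ` A" if "A \<subseteq> t" for A using L(3) that by (intro image_cong) auto
    show poly: "polytope (g ` t)"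
      unfolding eq[OF order_refl] using polytope_affine_image[OF L(1)] polytope_cell[OF t] by blast
    show "\<exists>d>0. \<forall>x\<in>interior (g ` t). c x = d"
      using L(2,4) k[OF t] by (intro exI[of _ "k t / det (matrix L)"]) simp
    have "measure lebesgue (g ` t) = det (matrix L) * measure lebesgue t"
      unfolding eq[OF order_refl] using measure_affine_image[OF L(1) polytope_cell[OF t]] L(2) by simp
    then have "k t / det (matrix L) * measure lebesgue (g ` t) = k t * measure lebesgue t"
      using L(2) by simp
    then show "(c has_integral k t * measure lebesgue t) (g ` t)"
      using has_integral_const_interior[OF poly L(4)] by simp
    show "negligible (g ` A)" if A: "A \<subseteq> t" "negligible A" for A
    proof -
      have "(\<lambda>x. L x + b) ` A = (+) b ` (L ` A)" by (auto simp: image_image add.commute)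
      moreover have "negligible (L ` A)"
        using A(2) measure_linear_image_finite[OF L(1), of A] by (simp add: negligible_iff_measure)
      ultimately show ?thesis
        unfolding eq[OF A(1)] using negligible_translation by metis
    qed
  qed
  have U: "\<Union>((`) g ` T) = P" using gQ(1) T(2) by blast
  show "piecewise_constant_density P c"
    unfolding piecewise_constant_density_def
  proof (intro exI[of _ "(`) g ` T"] conjI ballI)
    show "finite ((`) g ` T)" using finite_T by simp
    show "\<Union>((`) g ` T) = P" by (rule U)
    fix X assume "X \<in> (`) g ` T"
    then obtain t where "t \<in> T" "X = g ` t" by blast
    then show "polytope X" "\<exists>k>0. \<forall>x\<in>interior X. c x = k" using gt(1,2) by auto
  qed
  have "(c has_integral (\<Sum>t\<in>T. k t * measure lebesgue t)) (\<Union>t\<in>T. g ` t)"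
  proof (rule has_integral_UN[OF finite_T gt(3)])
    show "pairwise (\<lambda>t t'. negligible (g ` t \<inter> g ` t')) T"
    proof (rule pairwiseI)
      fix t t' assume t: "t \<in> T" "t' \<in> T" "t \<noteq> t'"
      \<comment> \<open>By injectivity the overlap of the images is the image of a negligible
        overlap.\<close>
      have "g ` t \<inter> g ` t' = g ` (t \<inter> t')"
        using gQ(2) t T(2) by (intro inj_on_image_Int[symmetric]) auto
      then show "negligible (g ` t \<inter> g ` t')"
        using gt(4)[OF t(1), of "t \<inter> t'"] negligible_Int[OF t] by simp
    qed
  qed
  then have 1: "integral P c = (\<Sum>t\<in>T. k t * measure lebesgue t)" using U by (simp add: integral_unique)
  have "(e has_integral k t * measure lebesgue t) t" if "t \<in> T" for t
    using has_integral_const_interior[OF polytope_cell[OF that], of e "k t"] k[OF that] by blast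
  then have "(e has_integral (\<Sum>t\<in>T. k t * measure lebesgue t)) (\<Union>T)"
    by (intro has_integral_Union finite_T) (auto simp: pairwise_def negligible_Int)
  then have "integral Q e = (\<Sum>t\<in>T. k t * measure lebesgue t)" using T(2) by (simp add: integral_unique)
  then show "integral P c = integral Q e" using 1 by simp
qed

lemma PL_transport_same_polytope:
  fixes P :: "(real^'n) set"
  assumes P: "polytope P" "interior P \<noteq> {}"
    and c: "piecewise_constant_density P c" and e: "piecewise_constant_density P e"
    and total: "integral P c = integral P e"
  shows "\<exists>f. PL_transport 1 P c P e f"
proof -
  obtain C where C: "finite C" "\<forall>X\<in>C. polytope X" "\<Union>C = P" "\<forall>X\<in>C. \<exists>k>0. \<forall>x\<in>interior X. c x = k"
    using c unfolding piecewise_constant_density_def by (elim conjE exE)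
  obtain E where E: "finite E" "\<forall>X\<in>E. polytope X" "\<Union>E = P" "\<forall>X\<in>E. \<exists>k>0. \<forall>x\<in>interior X. e x = k"
    using e unfolding piecewise_constant_density_def by (elim conjE exE)
  have fin: "finite (C \<union> E)" and poly: "\<forall>X\<in>C \<union> E. polytope X"
    using C(1,2) E(1,2) by auto
  obtain T where T': "triangulation T" "\<Union>T = P" "\<forall>t\<in>T. int CARD('n) simplex t"
    "\<forall>N\<subseteq>C \<union> E. \<Union>N = P \<longrightarrow> (\<forall>t\<in>T. \<exists>X\<in>N. t \<subseteq> X)"
    by (rule triangulation_refining[OF P fin poly])
  note T = T'(1,2) T'(3,4)[rule_format]
  interpret simplicial_partition T by (rule simplicial_partition_triangulation[OF T(1,3)])
  \<comment> \<open>Formulated for any cover \<open>N\<close> taken from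
    \<open>C \<union> E\<close>, so that the masses of \<open>c\<close> and \<open>e\<close> are
    read off on the same triangulation.\<close>
  have masses: "\<exists>m. (\<forall>t\<in>T. m t > 0) \<and> has_masses m d \<and> integral P d = sum m T"
    if N: "N \<subseteq> C \<union> E" "\<Union>N = P" "\<forall>X\<in>N. \<exists>k>0. \<forall>x\<in>interior X. d x = k" for N and d :: "real^'n \<Rightarrow> real"
  proof -
    have "\<exists>k. k > 0 \<and> (\<forall>x\<in>interior t. d x = k)" if t: "t \<in> T" for t
    proof -
      obtain X where X: "X \<in> N" "t \<subseteq> X" using T(4)[OF N(1,2) t] by blast
      then show ?thesis using N(3) interior_mono[OF X(2)] by blast
    qed
    then obtain k where k: "\<And>t. t \<in> T \<Longrightarrow> k t > 0" "\<And>t x. t \<in> T \<Longrightarrow> x \<in> interior t \<Longrightarrow> d x = k t"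
      by metis
    have "(d has_integral k t * measure lebesgue t) t" if "t \<in> T" for t
      using has_integral_const_interior[OF polytope_cell[OF that] k(2)[OF that]] .
    then have "(d has_integral (\<Sum>t\<in>T. k t * measure lebesgue t)) (\<Union>T)"
      by (intro has_integral_Union finite_T) (auto simp: pairwise_def negligible_Int)
    then have "integral P d = (\<Sum>t\<in>T. k t * measure lebesgue t)" using T(2) by (simp add: integral_unique)
    moreover have "has_masses (\<lambda>t. k t * measure lebesgue t) d"
      unfolding has_masses_def using k(2) measure_cell_pos by fastforce
    ultimately show ?thesis
      using k(1) measure_cell_pos by (intro exI[of _ "\<lambda>t. k t * measure lebesgue t"]) simp
  qed
  obtain m where m: "\<And>t. t \<in> T \<Longrightarrow> m t > 0" "has_masses m c" "integral P c = sum m T"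
    using masses[OF _ C(3,4)] by blast
  obtain n where n: "\<And>t. t \<in> T \<Longrightarrow> n t > 0" "has_masses n e" "integral P e = sum n T"
    using masses[OF _ E(3,4)] by blast
  have "transportable m n"
  proof (rule transportable_same_total[OF _ n(1) m(1)])
    show "adjacent\<^sup>*\<^sup>* X Y" if "X \<in> T" "Y \<in> T" for X Y
      using adjacent_connected[OF _ that] T(2) polytope_imp_convex[OF P(1)] by simp
    show "sum m T = sum n T" using m(3) n(3) total by simp
  qed
  then show ?thesis using m(2) n(2) T(2) unfolding transportable_def by blast
qed

section \<open>Volume forms and their pullbacks\<close>

lemma std_volume_form_linear:
  fixes L :: "real^'n \<Rightarrow> real^'n"
  assumes "linear L"
  shows "std_volume_form (\<lambda>i. L (v i)) = det (matrix L) * std_volume_form v"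
proof -
  \<comment> \<open>The vectors are rows here, so \<open>L\<close> acts by multiplication with its
    transpose from the right.\<close>
  have "(\<chi> i j. L (v i) $ j) = (\<chi> i j. v i $ j) ** transpose (matrix L)"
  proof -
    have "L (v i) $ j = (\<Sum>k\<in>UNIV. v i $ k * transpose (matrix L) $ k $ j)" for i j
    proof -
      have "L (v i) = matrix L *v v i" using matrix_vector_mul(2)[OF assms] by metis
      then show ?thesis by (simp add: matrix_vector_mult_def transpose_def mult.commute)
    qed
    then show ?thesis by (simp add: vec_eq_iff matrix_matrix_mult_def)
  qed
  then show ?thesis by (simp add: std_volume_form_def det_mul)
qed

text \<open>The cells of a transport may overlap, so they are refined to a triangulation. Its closed
  simplices give continuity, hence a homeomorphism by compactness, and on their interiors the affine
  pieces are the derivatives that enter the pullback.\<close>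

lemma PL_transport_volume_preserving:
  fixes P Q :: "(real^'n) set"
  assumes P: "polytope P" "interior P \<noteq> {}" and f: "PL_transport 1 P c Q e f"
    and \<omega>1: "\<And>x v. x \<in> P \<Longrightarrow> \<omega>1 x v = c x * std_volume_form v"
    and \<omega>2: "\<And>x v. x \<in> Q \<Longrightarrow> \<omega>2 x v = e x * std_volume_form v"
  shows "PL_homeomorphism P Q f \<and> volume_preserving P \<omega>1 \<omega>2 f"
proof -
  obtain D where D: "finite D" "\<forall>X\<in>D. polytope X" "\<Union>D = P"
      "\<forall>X\<in>D. \<exists>L b. linear L \<and> 1 * det (matrix L) > 0 \<and> (\<forall>x\<in>X. f x = L x + b) \<and>
         (\<forall>x\<in>interior X. \<bar>det (matrix L)\<bar> * e (f x) = c x)"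
    using f unfolding PL_transport_def by (elim conjE exE)
  have fP: "f ` P = Q" "inj_on f P" using f PL_transport_image PL_transport_inj_on by blast+
  obtain T where T': "triangulation T" "\<Union>T = P" "\<forall>t\<in>T. int CARD('n) simplex t"
    "\<forall>N\<subseteq>D. \<Union>N = P \<longrightarrow> (\<forall>t\<in>T. \<exists>X\<in>N. t \<subseteq> X)"
    by (rule triangulation_refining[OF P D(1) D(2)])
  note T = T'(1,2) T'(3,4)[rule_format]
  interpret simplicial_partition T by (rule simplicial_partition_triangulation[OF T(1,3)])
  \<comment> \<open>The positive determinant allows the absolute value to be dropped, as the signed
    identity of forms requires.\<close>
  have piece: "\<exists>L b. linear L \<and> det (matrix L) > 0 \<and> (\<forall>x\<in>t. f x = L x + b) \<and>
         (\<forall>x\<in>interior t. det (matrix L) * e (f x) = c x)" if t: "t \<in> T" for t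
  proof -
    obtain X where X: "X \<in> D" "t \<subseteq> X" using T(4)[of D] D(3) t by auto
    obtain L b where L: "linear L" "det (matrix L) > 0" "\<And>x. x \<in> X \<Longrightarrow> f x = L x + b"
      "\<And>x. x \<in> interior X \<Longrightarrow> \<bar>det (matrix L)\<bar> * e (f x) = c x"
      using D(4) X(1) by fastforce
    then show ?thesis
      using X(2) interior_mono[OF X(2)] by (intro exI[of _ L] exI[of _ b]) (auto simp: subset_iff)
  qed
  have "continuous_on (\<Union>T) f"
  proof (rule continuous_on_closed_Union[of T "\<lambda>t. t", simplified])
    show "finite T" by (rule finite_T)
    fix t assume t: "t \<in> T"
    show "closed t" using polytope_imp_closed polytope_cell[OF t] by blast
    obtain L b where L: "linear L" "\<And>x. x \<in> t \<Longrightarrow> f x = L x + b" using piece[OF t] by blast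
    have "continuous_on t (\<lambda>x. L x + b)"
      using L(1) by (intro continuous_intros linear_continuous_on linear_conv_bounded_linear[THEN iffD1])
    then show "continuous_on t f" using L(2) by (simp cong: continuous_on_cong)
  qed
  then have "\<exists>g. homeomorphism P Q f g"
    using homeomorphism_compact[OF polytope_imp_compact[OF P(1)] _ fP] T(2) by simp
  moreover have "piecewise_linear_on P f"
    unfolding piecewise_linear_on_def
  proof (intro exI[of _ T] conjI ballI T(1,2))
    fix t assume "t \<in> T"
    from piece[OF this] show "\<exists>L b. linear L \<and> (\<forall>x\<in>t. f x = L x + b)" by blast
  qed
  moreover have "volume_preserving P \<omega>1 \<omega>2 f"
    unfolding volume_preserving_def
  proof (intro exI[of _ T] conjI ballI)
    show "polyhedral_decomposition T P"
      unfolding polyhedral_decomposition_def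
    proof (intro conjI ballI impI finite_T T(2))
      show "polytope t" if "t \<in> T" for t using polytope_cell[OF that] .
      show "interior X \<inter> interior Y = {}" if "X \<in> T" "Y \<in> T" "X \<noteq> Y" for X Y
        using Int_interior_cell[OF that] interior_subset[of Y] by blast
    qed
    fix t x assume t: "t \<in> T" and x: "x \<in> interior t"
    obtain L b where L: "linear L" "det (matrix L) > 0" "\<And>x. x \<in> t \<Longrightarrow> f x = L x + b"
      "\<And>x. x \<in> interior t \<Longrightarrow> det (matrix L) * e (f x) = c x" using piece[OF t] by blast
    have "((\<lambda>x. L x + b) has_derivative L) (at x)"
      using L(1) by (auto intro!: derivative_eq_intros linear_imp_has_derivative)
    then have der: "(f has_derivative L) (at x)"
    proof (rule has_derivative_transform_within_open[OF _ open_interior x])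
      show "L y + b = f y" if "y \<in> interior t" for y using L(3) that interior_subset by (metis subsetD)
    qed
    then show "f differentiable at x" by (rule differentiableI)
    have xP: "x \<in> P" using x t T(2) interior_subset by blast
    then have fQ: "f x \<in> Q" using fP(1) by blast
    have "frechet_derivative f (at x) = L" using der by (rule frechet_derivative_at[symmetric])
    then have "pullback f \<omega>2 x v = \<omega>1 x v" for v
      by (simp add: pullback_def \<omega>1[OF xP] \<omega>2[OF fQ] std_volume_form_linear[OF L(1)] L(4)[OF x, symmetric])
    then show "pullback f \<omega>2 x = \<omega>1 x" by blast
  qed
  ultimately show ?thesis unfolding PL_homeomorphism_def by blast
qed

lemma piecewise_constant_volume_form_density:
  fixes P :: "(real^'n) set" and \<omega> :: "'n form"
  assumes "piecewise_constant_volume_form P \<omega>"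
  obtains c where "piecewise_constant_density P c" "\<And>x v. x \<in> P \<Longrightarrow> \<omega> x v = c x * std_volume_form v"
    "form_integral P \<omega> = integral P c"
proof -
  obtain c D where D: "polyhedral_decomposition D P" "\<forall>x\<in>P. c x > 0" "\<forall>X\<in>D. c constant_on interior X"
    "\<forall>x\<in>P. \<forall>v. \<omega> x v = c x * std_volume_form v"
    using assms unfolding piecewise_constant_volume_form_def by blast
  have U: "\<Union>D = P" "finite D" "\<forall>X\<in>D. polytope X"
    using D(1) unfolding polyhedral_decomposition_def by blast+
  have "\<exists>k>0. \<forall>x\<in>interior X. c x = k" if X: "X \<in> D" for X
  proof (cases "interior X = {}")
    \<comment> \<open>A flat cell offers no point at which to read off a positive value, so 1 stands
      in.\<close>
    case True
    then show ?thesis by (intro exI[of _ 1]) simp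
  next
    case False
    then obtain y where y: "y \<in> interior X" by blast
    have "y \<in> P" using y X U(1) interior_subset by blast
    moreover obtain k where "\<forall>x\<in>interior X. c x = k" using D(3) X unfolding constant_on_def by blast
    ultimately show ?thesis using D(2) y by metis
  qed
  then have "piecewise_constant_density P c" using U unfolding piecewise_constant_density_def by blast
  moreover have "std_volume_form (\<lambda>i::'n. axis i 1) = 1"
  proof -
    have "(\<chi> i j. axis i 1 $ j) = (mat 1 :: real^'n^'n)"
      by (auto simp: vec_eq_iff mat_def axis_def)
    then show ?thesis by (simp only: std_volume_form_def det_I)
  qed
  then have "form_integral P \<omega> = integral P c"
    unfolding form_integral_def using D(4) by (intro integral_cong) simp
  ultimately show thesis using that D(4) by blast
qed

theorem theorem4p7:
  fixes P Q :: "(real ^ 'n) set" and \<omega>1 \<omega>2 :: "'n form"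
  assumes "polytope P" and "interior P \<noteq> {}"
    and "polytope Q" and "interior Q \<noteq> {}"
    and "piecewise_constant_volume_form P \<omega>1"
    and "piecewise_constant_volume_form Q \<omega>2"
    and "form_integral P \<omega>1 = form_integral Q \<omega>2"
  shows "\<exists>f. PL_homeomorphism P Q f \<and> volume_preserving P \<omega>1 \<omega>2 f"
proof -
  obtain c1 where c1: "piecewise_constant_density P c1" "\<And>x v. x \<in> P \<Longrightarrow> \<omega>1 x v = c1 x * std_volume_form v"
    "form_integral P \<omega>1 = integral P c1"
    using piecewise_constant_volume_form_density[OF assms(5)] by blast
  obtain c2 where c2: "piecewise_constant_density Q c2" "\<And>x v. x \<in> Q \<Longrightarrow> \<omega>2 x v = c2 x * std_volume_form v"
    "form_integral Q \<omega>2 = integral Q c2"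
    using piecewise_constant_volume_form_density[OF assms(6)] by blast
  obtain c f where f: "PL_transport 1 P c Q c2 f"
    using PL_equivalent_polytopes[OF assms(1-4)] unfolding PL_equivalent_def by blast
  \<comment> \<open>Read through the inverse of \<open>f\<close>, \<open>c\<close> is a piecewise
    constant density on \<open>P\<close> with the integral of \<open>c2\<close>. Now two densities
    of equal mass live on the same polytope.\<close>
  note c = PL_transport_density[OF assms(3,4) PL_transport_inverse[OF f] c2(1)]
  obtain h where h: "PL_transport 1 P c1 P c h"
    using PL_transport_same_polytope[OF assms(1,2) c1(1) c(1)] assms(7) c1(3) c2(3) c(2) by auto
  have "PL_transport 1 P c1 Q c2 (f \<circ> h)" using PL_transport_comp[OF h f] by simp
  from PL_transport_volume_preserving[OF assms(1,2) this c1(2) c2(2)] show ?thesis by blast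
qed

end
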